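(* Let $\mathcal{H}$ be a complex Hilbert space and $d\in\mathbb{N}$. Let $\mathbf{T}\in\mathfrak{B}(\mathcal{H})^d$ be a pure spherically quasinormal $d$-tuple with the minimal normal extension $\mathbf{N}\in\mathfrak{B}(\mathcal{K})^d$, $\mathcal{K}\supseteq\mathcal{H}$, and the corresponding dual $\mathbf{S}\in\mathfrak{B}(\mathcal{K}\ominus\mathcal{H})^d$. Then the following conditions are equivalent: (i) $\mathbf{N}$ is Taylor invertible; (ii) $\mathcal{R}(\mathbf{N})$ is closed; (iii) $\mathcal{R}(\mathbf{T})$ and $\mathcal{R}(\mathbf{S})$ are closed; (iv) $\mathbf{T}$ and $\mathbf{S}$ are left Taylor invertible.
   Context: $\mathfrak{B}(\mathcal{H})$ is the algebra of bounded linear operators on $\mathcal{H}$. $\mathbf{T}=(T_1,\ldots,T_d)\in\mathfrak{B}(\mathcal{H})^d$ is spherically quasinormal if each $T_i$ commutes with $\sum_{j=1}^dT_j^*T_j$. A $d$-tuple is normal if it is commuting and each of its entries is a normal operator. $\mathbf{T}$ is pure if there is no non-zero closed subspace $\mathcal{M}\subseteq\mathcal{H}$ that reduces every $T_k$ and for which the compressions (restrictions) of $T_1,\ldots,T_d$ to $\mathcal{M}$ form a normal $d$-tuple on $\mathcal{M}$. A normal extension of $\mathbf{T}$ is a normal $d$-tuple $\mathbf{N}=(N_1,\ldots,N_d)\in\mathfrak{B}(\mathcal{K})^d$ on a Hilbert space $\mathcal{K}\supseteq\mathcal{H}$ with $N_k\mathcal{H}\subseteq\mathcal{H}$ and $N_k|_{\mathcal{H}}=T_k$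 for every $k$; it is the minimal normal extension if no proper closed subspace of $\mathcal{K}$ containing $\mathcal{H}$ reduces every $N_k$. If $\mathbf{N}$ is the minimal normal extension of $\mathbf{T}$, write, with respect to $\mathcal{K}=\mathcal{H}\oplus\mathcal{H}^\perp$, where $\mathcal{H}^\perp=\mathcal{K}\ominus\mathcal{H}$, $$N_k=\begin{bmatrix}T_k&A_k\\0&S_k^*\end{bmatrix},\quad k\in\{1,\ldots,d\};$$ then $\mathbf{S}=(S_1,\ldots,S_d)\in\mathfrak{B}(\mathcal{K}\ominus\mathcal{H})^d$ is called the dual of $\mathbf{T}$. For a $d$-tuple $\mathbf{A}=(A_1,\ldots,A_d)$ on a Hilbert space $\mathcal{L}$, regarded as the column operator $\mathcal{L}\to\mathcal{L}^d$, $x\mapsto(A_1x,\ldots,A_dx)$: $\mathcal{N}(\mathbf{A})=\bigcap_{k=1}^d\mathcal{N}(A_k)$ and $\mathcal{R}(\mathbf{A})=\{(A_1x,\ldots,A_dx):x\in\mathcal{L}\}\subseteq\mathcal{L}^d$. $\mathbf{A}$ is left Taylor invertible if $\mathcal{N}(\mathbf{A})=\{0\}$ and $\mathcal{R}(\mathbf{A})$ is closed in $\mathcal{L}^d$. A commuting tuple $\mathbf{A}$ is Taylor invertible if its Koszul complex is exact; the Koszul complex is $0\to\Lambda^0\otimes\mathcal{L}\to\Lambda^1\otimes\mathcal{L}\to\cdots\to\Lambda^d\otimes\mathcal{L}\to0$, where $\Lambda^p=\Lambda^p(\mathbb{C}^d)$, with differential $\omega\otimes x\mapsto\sum_{k=1}^d(e_k\wedge\omega)\otimes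 A_kx$ (for $d=2$: $0\to\mathcal{L}\xrightarrow{(A_1,A_2)^{T}}\mathcal{L}\oplus\mathcal{L}\xrightarrow{(-A_2\ A_1)}\mathcal{L}\to0$). *)

theory Defs
  imports "HOL-Analysis.Analysis"
begin

text \<open>
  The real inner product, norm and topology of a complex inner product space are those of
  \<^class>\<open>real_inner\<close>; the complex inner product, linear in its first argument, has the real one as
  its real part, so that it is positive definite and induces the norm.
\<close>

class complex_inner = real_inner +
  fixes scaleC :: "complex \<Rightarrow> 'a \<Rightarrow> 'a" (infixr "*\<^sub>C" 75)
    and cinner :: "'a \<Rightarrow> 'a \<Rightarrow> complex"
  assumes scaleC_add_right: "a *\<^sub>C (x + y) = a *\<^sub>C x + a *\<^sub>C y"
    and scaleC_add_left: "(a + b) *\<^sub>C x = a *\<^sub>C x + b *\<^sub>C x"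
    and scaleC_scaleC: "a *\<^sub>C b *\<^sub>C x = (a * b) *\<^sub>C x"
    and scaleC_of_real: "complex_of_real r *\<^sub>C x = r *\<^sub>R x"
    and cinner_add_left: "cinner (x + y) z = cinner x z + cinner y z"
    and cinner_scaleC_left: "cinner (a *\<^sub>C x) y = a * cinner x y"
    and cinner_commute: "cinner x y = cnj (cinner y x)"
    and Re_cinner: "Re (cinner x y) = inner x y"

class chilbert_space = complex_inner + complete_space

global_interpretation complex_vector:
  vector_space "scaleC :: complex \<Rightarrow> 'a \<Rightarrow> 'a::complex_inner"
  defines csubspace = complex_vector.subspace
proof
  fix x :: 'a
  show "1 *\<^sub>C x = x"
    using scaleC_of_real[of 1 x] by simp
qed (simp_all add: scaleC_add_right scaleC_add_left scaleC_scaleC)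

text \<open>
  The Hilbert spaces below are closed subspaces \<open>L\<close> of an ambient Hilbert space. An operator on
  \<open>L\<close> is a function on the ambient space of which only the values on \<open>L\<close> matter; in particular
  its restriction to a smaller subspace is the same function. Tuples are indexed by \<open>{1..d}\<close>.
\<close>

definition closed_csubspace :: "'a::complex_inner set \<Rightarrow> bool" where
  "closed_csubspace M \<longleftrightarrow> csubspace M \<and> closed M"

definition ortho_diff :: "'a::complex_inner set \<Rightarrow> 'a set \<Rightarrow> 'a set" (infixl "\<ominus>" 65) where
  "L \<ominus> M = {x \<in> L. \<forall>y\<in>M. cinner x y = 0}"

definition bounded_op :: "'a::complex_inner set \<Rightarrow> 'a set \<Rightarrow> ('a \<Rightarrow> 'a) \<Rightarrow> bool" where
  "bounded_op L M A \<longleftrightarrow>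
     (\<forall>x\<in>L. A x \<in> M) \<and>
     (\<forall>x\<in>L. \<forall>y\<in>L. A (x + y) = A x + A y) \<and>
     (\<forall>c. \<forall>x\<in>L. A (c *\<^sub>C x) = c *\<^sub>C A x) \<and>
     (\<exists>B. \<forall>x\<in>L. norm (A x) \<le> B * norm x)"

definition adj :: "'a::complex_inner set \<Rightarrow> ('a \<Rightarrow> 'a) \<Rightarrow> 'a \<Rightarrow> 'a" where
  "adj L A y = (THE z. z \<in> L \<and> (\<forall>x\<in>L. cinner (A x) y = cinner x z))"

definition reduces :: "'a::complex_inner set \<Rightarrow> 'a set \<Rightarrow> ('a \<Rightarrow> 'a) \<Rightarrow> bool" where
  "reduces L M A \<longleftrightarrow> A ` M \<subseteq> M \<and> A ` (L \<ominus> M) \<subseteq> L \<ominus> M"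

definition bounded_tuple :: "nat \<Rightarrow> 'a::complex_inner set \<Rightarrow> (nat \<Rightarrow> 'a \<Rightarrow> 'a) \<Rightarrow> bool" where
  "bounded_tuple d L A \<longleftrightarrow> (\<forall>k\<in>{1..d}. bounded_op L L (A k))"

definition commuting_tuple :: "nat \<Rightarrow> 'a::complex_inner set \<Rightarrow> (nat \<Rightarrow> 'a \<Rightarrow> 'a) \<Rightarrow> bool" where
  "commuting_tuple d L A \<longleftrightarrow>
     (\<forall>i\<in>{1..d}. \<forall>j\<in>{1..d}. \<forall>x\<in>L. A i (A j x) = A j (A i x))"

definition normal_tuple :: "nat \<Rightarrow> 'a::complex_inner set \<Rightarrow> (nat \<Rightarrow> 'a \<Rightarrow> 'a) \<Rightarrow> bool" where
  "normal_tuple d L A \<longleftrightarrow>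
     bounded_tuple d L A \<and> commuting_tuple d L A \<and>
     (\<forall>k\<in>{1..d}. \<forall>x\<in>L. A k (adj L (A k) x) = adj L (A k) (A k x))"

definition spherically_quasinormal ::
  "nat \<Rightarrow> 'a::complex_inner set \<Rightarrow> (nat \<Rightarrow> 'a \<Rightarrow> 'a) \<Rightarrow> bool" where
  "spherically_quasinormal d L T \<longleftrightarrow>
     bounded_tuple d L T \<and>
     (\<forall>i\<in>{1..d}. \<forall>x\<in>L.
        T i (\<Sum>j=1..d. adj L (T j) (T j x)) = (\<Sum>j=1..d. adj L (T j) (T j (T i x))))"

definition pure_tuple :: "nat \<Rightarrow> 'a::complex_inner set \<Rightarrow> (nat \<Rightarrow> 'a \<Rightarrow> 'a) \<Rightarrow> bool" where
  "pure_tuple d L T \<longleftrightarrow>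
     \<not> (\<exists>M. closed_csubspace M \<and> M \<subseteq> L \<and> M \<noteq> {0} \<and>
            (\<forall>k\<in>{1..d}. reduces L M (T k)) \<and> normal_tuple d M T)"

text \<open>In the next two definitions \<open>\<K>\<close> is the whole type.\<close>

definition minimal_normal_extension ::
  "nat \<Rightarrow> 'a::complex_inner set \<Rightarrow> (nat \<Rightarrow> 'a \<Rightarrow> 'a) \<Rightarrow> (nat \<Rightarrow> 'a \<Rightarrow> 'a) \<Rightarrow> bool" where
  "minimal_normal_extension d H T N \<longleftrightarrow>
     normal_tuple d UNIV N \<and>
     (\<forall>k\<in>{1..d}. N k ` H \<subseteq> H \<and> (\<forall>x\<in>H. N k x = T k x)) \<and>
     \<not> (\<exists>M. closed_csubspace M \<and> M \<noteq> UNIV \<and> H \<subseteq> M \<and> (\<forall>k\<in>{1..d}. reduces UNIV M (N k)))"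

text \<open>\<open>A\<close> is the upper right corner of the block matrix of \<open>N k\<close>.\<close>

definition is_dual ::
  "nat \<Rightarrow> 'a::complex_inner set \<Rightarrow> (nat \<Rightarrow> 'a \<Rightarrow> 'a) \<Rightarrow> (nat \<Rightarrow> 'a \<Rightarrow> 'a) \<Rightarrow>
    (nat \<Rightarrow> 'a \<Rightarrow> 'a) \<Rightarrow> bool" where
  "is_dual d H T N S \<longleftrightarrow>
     bounded_tuple d (UNIV \<ominus> H) S \<and>
     (\<forall>k\<in>{1..d}. \<exists>A. bounded_op (UNIV \<ominus> H) H A \<and>
        (\<forall>x\<in>H. \<forall>y\<in>UNIV \<ominus> H. N k (x + y) = (T k x + A y) + adj (UNIV \<ominus> H) (S k) y))"

definition tuple_kernel :: "nat \<Rightarrow> 'a::complex_inner set \<Rightarrow> (nat \<Rightarrow> 'a \<Rightarrow> 'a) \<Rightarrow> 'a set" where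
  "tuple_kernel d L A = {x \<in> L. \<forall>k\<in>{1..d}. A k x = 0}"

definition tuple_range ::
  "nat \<Rightarrow> 'a::complex_inner set \<Rightarrow> (nat \<Rightarrow> 'a \<Rightarrow> 'a) \<Rightarrow> (nat \<Rightarrow> 'a) set" where
  "tuple_range d L A = (\<lambda>x. \<lambda>k\<in>{1..d}. A k x) ` L"

definition closed_tuple_range ::
  "nat \<Rightarrow> 'a::complex_inner set \<Rightarrow> (nat \<Rightarrow> 'a \<Rightarrow> 'a) \<Rightarrow> bool" where
  "closed_tuple_range d L A \<longleftrightarrow>
     closedin (product_topology (\<lambda>k. top_of_set L) {1..d}) (tuple_range d L A)"

definition left_taylor_invertible ::
  "nat \<Rightarrow> 'a::complex_inner set \<Rightarrow> (nat \<Rightarrow> 'a \<Rightarrow> 'a) \<Rightarrow> bool" where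
  "left_taylor_invertible d L A \<longleftrightarrow> tuple_kernel d L A = {0} \<and> closed_tuple_range d L A"

text \<open>
  An element of \<open>\<Lambda>\<^sup>p \<otimes> L\<close> is given by its coefficients with respect to the basis of the
  \<open>e\<^sub>I = e\<^sub>i\<^sub>1 \<and> \<dots> \<and> e\<^sub>i\<^sub>p\<close>, where \<open>I = {i\<^sub>1 < \<dots> < i\<^sub>p} \<subseteq> {1..d}\<close>. The sign in the differential comes
  from \<open>e\<^sub>k \<and> e\<^sub>J\<^sub>-\<^sub>{\<^sub>k\<^sub>} = (-1)\<^sup>m e\<^sub>J\<close> for \<open>k \<in> J\<close>, where \<open>m\<close> is the number of elements of \<open>J\<close> below \<open>k\<close>.
\<close>

definition koszul_space :: "nat \<Rightarrow> 'a::complex_inner set \<Rightarrow> nat \<Rightarrow> (nat set \<Rightarrow> 'a) set" where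
  "koszul_space d L p =
     {f. \<forall>I. if I \<subseteq> {1..d} \<and> card I = p then f I \<in> L else f I = 0}"

definition koszul_diff ::
  "nat \<Rightarrow> (nat \<Rightarrow> 'a \<Rightarrow> 'a) \<Rightarrow> (nat set \<Rightarrow> 'a) \<Rightarrow> nat set \<Rightarrow> 'a::complex_inner" where
  "koszul_diff d A f J =
     (if J \<subseteq> {1..d}
      then \<Sum>k\<in>J. (-1) ^ card {j\<in>J. j < k} *\<^sub>R A k (f (J - {k}))
      else 0)"

definition koszul_exact :: "nat \<Rightarrow> 'a::complex_inner set \<Rightarrow> (nat \<Rightarrow> 'a \<Rightarrow> 'a) \<Rightarrow> bool" where
  "koszul_exact d L A \<longleftrightarrow>
     {f \<in> koszul_space d L 0. koszul_diff d A f = (\<lambda>_. 0)} = {\<lambda>_. 0} \<and>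
     (\<forall>p<d. {f \<in> koszul_space d L (Suc p). koszul_diff d A f = (\<lambda>_. 0)} =
            koszul_diff d A ` koszul_space d L p)"

definition taylor_invertible :: "nat \<Rightarrow> 'a::complex_inner set \<Rightarrow> (nat \<Rightarrow> 'a \<Rightarrow> 'a) \<Rightarrow> bool" where
  "taylor_invertible d L A \<longleftrightarrow> commuting_tuple d L A \<and> koszul_exact d L A"

end

theory Submission
  imports Defs "HOL-Complex_Analysis.Complex_Analysis"
begin

text \<open>
  Put \<open>P = \<Sum>\<^sub>k N\<^sub>k\<^sup>*N\<^sub>k\<close>. Quasinormality of the tuple \<open>T\<close> makes \<open>H\<close> invariant under the
  self-adjoint \<open>P\<close>, so \<open>\<langle>Px, x\<rangle> = \<Sum>\<^sub>k \<bar>N\<^sub>k x\<bar>\<^sup>2\<close> splits along \<open>H\<close> and its orthogonal complement.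
  On \<open>H\<close> it is \<open>\<Sum>\<^sub>k \<bar>T\<^sub>k x\<bar>\<^sup>2\<close>; on the complement, where \<open>S\<^sub>k\<close> is the restriction of \<open>N\<^sub>k\<^sup>*\<close>, it is
  \<open>\<Sum>\<^sub>k \<bar>S\<^sub>k x\<bar>\<^sup>2\<close>. Purity of \<open>T\<close> and minimality of \<open>N\<close> make all three kernels trivial, and then a
  range is closed exactly if the corresponding quadratic form is bounded below. If \<open>P\<close> is bounded
  below it is invertible, and since by Fuglede's theorem all \<open>N\<^sub>i\<close> and \<open>N\<^sub>j\<^sup>*\<close> commute, the maps
  \<open>N\<^sub>k\<^sup>* P\<^sup>-\<^sup>1\<close> give a contracting homotopy of the Koszul complex.
\<close>

subsection \<open>Complex inner product spaces\<close>

\<comment> \<open>The quadratic form of \<open>P\<close> has to be used as a whole: for a single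
  \<open>k\<close> the vectors \<open>N\<^sub>k u\<close> and \<open>N\<^sub>k v\<close>, with
  \<open>u\<close> in \<open>H\<close> and \<open>v\<close> orthogonal to \<open>H\<close>, need not
  be orthogonal, and the cross terms cancel only after summation over \<open>k\<close>.

  The passage from Taylor invertibility back to a closed range uses exactness in degree one alone:
  the range of \<open>N\<close> is then the kernel of a continuous map.

  An operator on a subspace is a total function that is linear and bounded only there. This shapes
  the analytic tools: the Riesz representation, the adjoint and the bounded inverse theorem are all
  stated relative to a closed set \<open>L\<close>, so that one version serves \<open>H\<close>, its
  complement and the whole space.\<close>
subclass (in chilbert_space) banach ..

lemma cinner_add_right: "cinner x (y + z) = cinner x y + cinner x z"
  by (metis cinner_add_left cinner_commute complex_cnj_add)

lemma cinner_scaleC_right: "cinner x (a *\<^sub>C y) = cnj a * cinner x y"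
  by (metis cinner_commute cinner_scaleC_left complex_cnj_mult)

lemma cinner_scaleR_left: "cinner (r *\<^sub>R x) y = of_real r * cinner x y"
  by (metis cinner_scaleC_left scaleC_of_real)

lemma cinner_scaleR_right: "cinner x (r *\<^sub>R y) = of_real r * cinner x y"
  by (metis cinner_scaleC_right scaleC_of_real complex_cnj_complex_of_real)

lemma cinner_self: "cinner x x = of_real ((norm x)\<^sup>2)"
proof -
  have "Im (cinner x x) = 0"
    using arg_cong[OF cinner_commute[of x x], of Im] by simp
  then show ?thesis
    by (simp add: complex_eq_iff Re_cinner power2_norm_eq_inner)
qed

lemma norm_scaleC: "norm (a *\<^sub>C x) = cmod a * norm x"
proof -
  have "complex_of_real ((norm (a *\<^sub>C x))\<^sup>2) = a * cnj a * of_real ((norm x)\<^sup>2)"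
    by (metis cinner_self cinner_scaleC_left cinner_scaleC_right mult.assoc mult.commute)
  also have "\<dots> = of_real ((cmod a * norm x)\<^sup>2)"
    by (simp add: complex_norm_square[symmetric] power_mult_distrib)
  finally have "(norm (a *\<^sub>C x))\<^sup>2 = (cmod a * norm x)\<^sup>2"
    using of_real_eq_iff by blast
  then show ?thesis by simp
qed

lemma norm_cinner: "cmod (cinner x y) \<le> norm x * norm y"
proof (cases "cinner x y = 0")
  case False
  \<comment> \<open>The unimodular factor \<open>c\<close> turns \<open>cinner x y\<close> onto the
    positive real axis, where it equals its real part, so that the real Cauchy-Schwarz inequality
    applies.\<close>
  define c where "c = cnj (cinner x y) / cmod (cinner x y)"
  have c: "cmod c = 1" using False by (simp add: c_def norm_divide)
  have "c * cinner x y = cmod (cinner x y)"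
    using False by (simp add: c_def complex_norm_square[symmetric] mult.commute power2_eq_square)
  then have "cmod (cinner x y) = inner (c *\<^sub>C x) y"
    by (metis Re_cinner Re_complex_of_real cinner_scaleC_left)
  also have "\<dots> \<le> norm (c *\<^sub>C x) * norm y" by (rule norm_cauchy_schwarz)
  finally show ?thesis by (simp add: norm_scaleC c)
qed simp

lemma bounded_bilinear_cinner: "bounded_bilinear cinner"
  by standard (auto simp: cinner_add_left cinner_add_right cinner_scaleR_left cinner_scaleR_right
      scaleR_conv_of_real norm_cinner intro!: exI[of _ 1])

interpretation cinner: bounded_bilinear cinner
  by (rule bounded_bilinear_cinner)

lemma bounded_linear_scaleC: "bounded_linear (\<lambda>x. a *\<^sub>C x)"
  by (standard, simp add: scaleC_add_right)
    (metis scaleC_of_real scaleC_scaleC mult.commute, metis norm_scaleC mult.commute order_refl)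

lemma scaleC_diff_right: "a *\<^sub>C (x - y) = a *\<^sub>C x - a *\<^sub>C y"
  by (rule linear_diff[OF bounded_linear.linear[OF bounded_linear_scaleC]])

text \<open>The real inner product sees only real parts; the factors 1 and \<open>\<i>\<close>
  recover both parts. This carries the real Riesz representation over to the complex inner
  product.\<close>

lemma cinner_eq_inner_imp_eq:
  assumes "\<And>c. inner (c *\<^sub>C u) v = inner (c *\<^sub>C w) z"
  shows "cinner u v = cinner w z"
proof -
  have "Re (c * cinner u v) = Re (c * cinner w z)" for c
    using assms[of c] by (metis Re_cinner cinner_scaleC_left)
  from this[of 1] this[of \<i>] show ?thesis
    by (simp add: complex_eq_iff)
qed

subsection \<open>Riesz representation and adjoints\<close>

text \<open>If \<open>z\<close> represents \<open>f\<close>, then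
  \<open>(norm x)\<^sup>2 - 2 * f x\<close> is
  \<open>(norm (x - z))\<^sup>2 - (norm z)\<^sup>2\<close>. So \<open>z\<close> is sought as the
  minimiser of this functional on \<open>L\<close>: minimising sequences are Cauchy, and the first
  variation at the limit gives the representation.\<close>

lemma riesz_representation:
  fixes f :: "'a::{real_inner, complete_space} \<Rightarrow> real"
  assumes L: "subspace L" "closed L"
    and add: "\<And>x y. x \<in> L \<Longrightarrow> y \<in> L \<Longrightarrow> f (x + y) = f x + f y"
    and scale: "\<And>c x. x \<in> L \<Longrightarrow> f (c *\<^sub>R x) = c * f x"
    and bnd: "\<And>x. x \<in> L \<Longrightarrow> \<bar>f x\<bar> \<le> B * norm x"
  obtains z where "z \<in> L" "\<And>x. x \<in> L \<Longrightarrow> f x = inner x z"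
proof -
  define g where "g x = (norm x)\<^sup>2 - 2 * f x" for x
  define m where "m = Inf (g ` L)"
  have low: "g x \<ge> - B\<^sup>2" if "x \<in> L" for x
  proof -
    have "f x \<le> B * norm x" using bnd[OF that] by linarith
    moreover have "0 \<le> (norm x - B)\<^sup>2" by simp
    ultimately show ?thesis by (simp add: g_def power2_eq_square algebra_simps)
  qed
  have bdd: "bdd_below (g ` L)" using low by (auto intro!: bdd_belowI2)
  have m_le: "m \<le> g x" if "x \<in> L" for x
    unfolding m_def using that bdd by (rule cInf_lower[OF imageI])
  have L0: "0 \<in> L" using L by (simp add: subspace_0)
  have "\<exists>x\<in>L. g x < m + 1 / Suc n" for n :: nat
  proof -
    have "Inf (g ` L) < m + 1 / Suc n" by (simp add: m_def)
    then show ?thesis using L0 bdd by (subst (asm) cInf_less_iff) auto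
  qed
  then obtain X where X: "\<And>n. X n \<in> L" "\<And>n. g (X n) < m + 1 / Suc n" by metis
  \<comment> \<open>Parallelogram law with the midpoint \<open>w\<close>:
    \<open>g x + g y - 2 * g w\<close> is half of \<open>(norm (x - y))\<^sup>2\<close>, and
    \<open>g w\<close> is at least \<open>m\<close>.\<close>
  have par: "(norm (x - y))\<^sup>2 \<le> 2 * (g x - m) + 2 * (g y - m)" if "x \<in> L" "y \<in> L" for x y
  proof -
    define w where "w = (1/2) *\<^sub>R (x + y)"
    have "w \<in> L" using L that by (simp add: w_def subspace_add subspace_scale)
    then have "m \<le> g w" by (rule m_le)
    moreover have "f w = (f x + f y) / 2"
      using L that by (simp add: w_def scale add subspace_add)
    moreover have "(norm w)\<^sup>2 = (inner x x + 2 * inner x y + inner y y) / 4"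
      unfolding power2_norm_eq_inner w_def by (simp add: inner_add inner_commute)
    moreover have "(norm (x - y))\<^sup>2 = inner x x - 2 * inner x y + inner y y"
      by (simp add: power2_norm_eq_inner inner_diff inner_commute)
    ultimately show ?thesis by (simp add: g_def power2_norm_eq_inner) (simp add: field_simps)
  qed
  have "Cauchy X"
  proof (rule metric_CauchyI)
    fix e :: real assume e: "e > 0"
    obtain M where M: "inverse (real (Suc M)) < e\<^sup>2 / 4"
      using reals_Archimedean[of "e\<^sup>2 / 4"] e by auto
    have "dist (X i) (X j) < e" if "i \<ge> M" "j \<ge> M" for i j
    proof -
      have "g (X k) - m < e\<^sup>2 / 4" if "k \<ge> M" for k
      proof -
        have "1 / real (Suc k) \<le> inverse (real (Suc M))" using that by (simp add: field_simps)
        then show ?thesis using X(2)[of k] M by linarith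
      qed
      from this[OF that(1)] this[OF that(2)] have "(norm (X i - X j))\<^sup>2 < e\<^sup>2"
        using par[OF X(1) X(1), of i j] by argo
      then show ?thesis using e by (simp add: dist_norm power_less_imp_less_base)
    qed
    then show "\<exists>M. \<forall>i\<ge>M. \<forall>j\<ge>M. dist (X i) (X j) < e" by blast
  qed
  then obtain z where z: "X \<longlonglongrightarrow> z" using Cauchy_convergent convergent_def by blast
  have zL: "z \<in> L" using closed_sequentially[OF L(2)] X(1) z by blast
  have gz: "g z \<le> m"
  proof -
    have "(\<lambda>n. f (X n)) \<longlonglongrightarrow> f z"
    proof (rule Lim_null[THEN iffD2], rule Lim_null_comparison)
      have "f (X n) - f z = f (X n - z)" for n
        using add[of "X n - z" z] X(1)[of n] zL L by (simp add: subspace_diff)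
      then show "\<forall>\<^sub>F n in sequentially. norm (f (X n) - f z) \<le> B * norm (X n - z)"
        using bnd X(1) zL L by (simp add: subspace_diff)
      show "(\<lambda>n. B * norm (X n - z)) \<longlonglongrightarrow> 0"
        using z by (auto intro!: tendsto_eq_intros)
    qed
    then have "(\<lambda>n. g (X n)) \<longlonglongrightarrow> g z" unfolding g_def by (intro tendsto_intros z)
    moreover have "(\<lambda>n. m + 1 / Suc n) \<longlonglongrightarrow> m"
      using tendsto_add[OF tendsto_const LIMSEQ_inverse_real_of_nat, of m] by (simp add: field_simps)
    ultimately show ?thesis using X(2) by (intro LIMSEQ_le[of _ _ _ m]) (auto intro: less_imp_le)
  qed
  have "f x = inner x z" if x: "x \<in> L" for x
  proof -
    define c where "c = inner x z - f x"
    define a where "a = (norm x)\<^sup>2"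
    have "0 \<le> 2 * t * c + t\<^sup>2 * a" for t :: real
    proof -
      have "g z \<le> g (z + t *\<^sub>R x)"
        using gz m_le[of "z + t *\<^sub>R x"] x zL L by (simp add: subspace_add subspace_scale)
      moreover have "(norm (z + t *\<^sub>R x))\<^sup>2 = (norm z)\<^sup>2 + 2 * t * inner x z + t\<^sup>2 * a"
        unfolding a_def power2_norm_eq_inner
        by (simp add: inner_add inner_commute power2_eq_square algebra_simps)
      ultimately show ?thesis
        using x zL L by (simp add: g_def c_def add scale subspace_scale algebra_simps)
    qed
    moreover have "a \<ge> 0" by (simp add: a_def)
    \<comment> \<open>The quadratic in \<open>t\<close> has its minimum at \<open>- c / a\<close>;
      the denominator \<open>1 + a\<close> also covers \<open>a = 0\<close> and still forces
      \<open>c = 0\<close>.\<close>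
    define t where "t = - c / (1 + a)"
    have t: "t * (1 + a) = - c" using \<open>a \<ge> 0\<close> by (simp add: t_def)
    ultimately have "0 \<le> (1 + a)\<^sup>2 * (2 * t * c + t\<^sup>2 * a)" by simp
    also have "\<dots> = 2 * (1 + a) * (t * (1 + a)) * c + (t * (1 + a))\<^sup>2 * a"
      by (simp add: power2_eq_square algebra_simps)
    finally have "0 \<le> - 2 * c\<^sup>2 * (1 + a) + c\<^sup>2 * a"
      unfolding t by (simp add: power2_eq_square algebra_simps)
    then have "c\<^sup>2 * (2 + a) \<le> 0" by (simp add: algebra_simps)
    with \<open>a \<ge> 0\<close> have "c\<^sup>2 \<le> 0" by (simp add: mult_le_0_iff)
    then show ?thesis by (simp add: c_def)
  qed
  then show ?thesis using that zL by blast
qed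

lemma csubspace_imp_subspace: "csubspace L \<Longrightarrow> subspace L"
  unfolding complex_vector.subspace_def subspace_def by (metis scaleC_of_real)

lemma
  assumes "closed_csubspace L"
  shows closed_csubspace_0: "0 \<in> L"
    and closed_csubspace_add: "x \<in> L \<Longrightarrow> y \<in> L \<Longrightarrow> x + y \<in> L"
    and closed_csubspace_diff: "x \<in> L \<Longrightarrow> y \<in> L \<Longrightarrow> x - y \<in> L"
    and closed_csubspace_scaleC: "x \<in> L \<Longrightarrow> c *\<^sub>C x \<in> L"
    and closed_csubspace_scaleR: "x \<in> L \<Longrightarrow> r *\<^sub>R x \<in> L"
    and closed_csubspace_sum: "(\<And>i. i \<in> I \<Longrightarrow> h i \<in> L) \<Longrightarrow> sum h I \<in> L"
  using assms csubspace_imp_subspace[of L] unfolding closed_csubspace_def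
  by (auto intro: subspace_0 subspace_add subspace_diff subspace_scale subspace_sum
      complex_vector.subspace_scale)

lemma closed_csubspace_UNIV: "closed_csubspace UNIV"
  by (simp add: closed_csubspace_def)

lemma closed_csubspace_ortho_diff:
  assumes "closed_csubspace L"
  shows "closed_csubspace (L \<ominus> M)"
proof -
  have "L \<ominus> M = L \<inter> (\<Inter>y\<in>M. {x. cinner x y = 0})"
    by (auto simp: ortho_diff_def)
  moreover have "closed {x. cinner x y = 0}" for y :: 'a
    by (intro closed_Collect_eq continuous_intros cinner.continuous_on)
  ultimately have "closed (L \<ominus> M)"
    using assms by (auto simp: closed_csubspace_def intro!: closed_Int closed_INT)
  then show ?thesis
    using assms unfolding closed_csubspace_def complex_vector.subspace_def
    by (auto simp: ortho_diff_def cinner_add_left cinner_scaleC_left cinner.zero_left)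
qed

lemma cinner_ortho_diff:
  assumes "x \<in> L \<ominus> M" "y \<in> M"
  shows "cinner x y = 0" "cinner y x = 0"
  using assms cinner_commute[of y x] by (auto simp: ortho_diff_def)

text \<open>The projection \<open>u\<close> of \<open>x\<close> is the vector that represents the
  functional \<open>inner _ x\<close> on \<open>L\<close>.\<close>

lemma orthogonal_decomposition:
  fixes x :: "'a::chilbert_space"
  assumes L: "closed_csubspace L"
  obtains u v where "u \<in> L" "v \<in> UNIV \<ominus> L" "x = u + v"
proof -
  have "\<exists>u\<in>L. \<forall>w\<in>L. inner w x = inner w u"
    by (rule riesz_representation[of L "\<lambda>w. inner w x" "norm x"])
      (use L csubspace_imp_subspace in \<open>auto simp: closed_csubspace_def inner_add_left
        Cauchy_Schwarz_ineq2 mult.commute\<close>)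
  then obtain u where u: "u \<in> L" "\<And>w. w \<in> L \<Longrightarrow> inner w x = inner w u" by blast
  have "cinner w x = cinner w u" if "w \<in> L" for w
    using u(2) L that by (intro cinner_eq_inner_imp_eq) (simp add: closed_csubspace_scaleC)
  then have "cinner w (x - u) = 0" if "w \<in> L" for w
    using that by (simp add: cinner.diff_right)
  then have "x - u \<in> UNIV \<ominus> L"
    by (auto simp: ortho_diff_def) (metis cinner_commute complex_cnj_zero)
  then show ?thesis using that[of u "x - u"] u(1) by simp
qed

section \<open>Adjoints of bounded operators\<close>

lemma
  fixes A :: "'a::chilbert_space \<Rightarrow> 'a"
  assumes L: "closed_csubspace L" and A: "bounded_op L M A"
  shows adj_mem: "adj L A y \<in> L"
    and cinner_adj: "x \<in> L \<Longrightarrow> cinner (A x) y = cinner x (adj L A y)"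
proof -
  obtain B where B: "\<And>x. x \<in> L \<Longrightarrow> norm (A x) \<le> B * norm x"
    using A unfolding bounded_op_def by blast
  have A_add: "A (x + y) = A x + A y" if "x \<in> L" "y \<in> L" for x y
    using A that by (auto simp: bounded_op_def)
  have A_scale: "A (c *\<^sub>C x) = c *\<^sub>C A x" if "x \<in> L" for c x
    using A that by (auto simp: bounded_op_def)
  have "\<exists>z\<in>L. \<forall>x\<in>L. inner (A x) y = inner x z"
  proof (rule riesz_representation[of L "\<lambda>x. inner (A x) y" "B * norm y"])
    show "inner (A (c *\<^sub>R x)) y = c * inner (A x) y" if "x \<in> L" for c x
      using A_scale[OF that, of "of_real c"] by (simp add: scaleC_of_real)
    show "\<bar>inner (A x) y\<bar> \<le> B * norm y * norm x" if "x \<in> L" for x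
      using Cauchy_Schwarz_ineq2[of "A x" y] mult_right_mono[OF B[OF that] norm_ge_zero[of y]]
      by (simp add: mult_ac)
  qed (use L csubspace_imp_subspace A_add in \<open>auto simp: closed_csubspace_def inner_add_left\<close>)
  then obtain z where z: "z \<in> L" "\<And>x. x \<in> L \<Longrightarrow> inner (A x) y = inner x z" by blast
  have ex: "cinner (A x) y = cinner x z" if "x \<in> L" for x
    using z(2) L that by (intro cinner_eq_inner_imp_eq) (simp add: closed_csubspace_scaleC flip: A_scale)
  have "adj L A y \<in> L \<and> (\<forall>x\<in>L. cinner (A x) y = cinner x (adj L A y))"
    unfolding adj_def
  proof (rule theI[of _ z])
    show "w = z" if "w \<in> L \<and> (\<forall>x\<in>L. cinner (A x) y = cinner x w)" for w
    proof -
      have "w - z \<in> L" using that z(1) L by (simp add: closed_csubspace_diff)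
      then have "cinner (w - z) (w - z) = 0"
        using that ex by (simp add: cinner.diff_right)
      then show ?thesis by (simp add: cinner_self)
    qed
  qed (use z ex in auto)
  then show "adj L A y \<in> L" "x \<in> L \<Longrightarrow> cinner (A x) y = cinner x (adj L A y)" by auto
qed

lemma adj_eqI:
  assumes "closed_csubspace L" "z \<in> L" "\<And>x. x \<in> L \<Longrightarrow> cinner (A x) y = cinner x z"
  shows "adj L A y = z"
  unfolding adj_def
proof (rule the_equality)
  fix w assume w: "w \<in> L \<and> (\<forall>x\<in>L. cinner (A x) y = cinner x w)"
  then have "w - z \<in> L" using assms by (simp add: closed_csubspace_diff)
  then have "cinner (w - z) (w - z) = 0" using w assms(3) by (simp add: cinner.diff_right)
  then show "w = z" by (simp add: cinner_self)
qed (use assms in auto)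

lemma cinner_left_eqI:
  assumes "\<And>x. cinner x y = cinner x z"
  shows "y = z"
proof -
  have "cinner (y - z) (y - z) = 0" using assms by (simp add: cinner.diff_right)
  then show ?thesis by (simp add: cinner_self)
qed

lemma adj_UNIV_unique:
  assumes "\<And>x. cinner (A x) y = cinner x z"
  shows "adj UNIV A y = z"
  using assms by (intro adj_eqI closed_csubspace_UNIV) auto

lemma bounded_op_bounded_linear:
  assumes "bounded_op UNIV UNIV A"
  shows "bounded_linear A"
proof -
  obtain B where "\<And>x. norm (A x) \<le> B * norm x" using assms by (auto simp: bounded_op_def)
  moreover have "A (r *\<^sub>R x) = r *\<^sub>R A x" for r x
    using assms unfolding bounded_op_def by (metis UNIV_I scaleC_of_real)
  ultimately show ?thesis
    using assms by (intro bounded_linear_intro[of _ B]) (auto simp: bounded_op_def mult.commute)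
qed

lemma bounded_op_adj:
  fixes A :: "'a::chilbert_space \<Rightarrow> 'a"
  assumes A: "bounded_op UNIV UNIV A"
  shows "bounded_op UNIV UNIV (adj UNIV A)"
proof -
  note adj = cinner_adj[OF closed_csubspace_UNIV A UNIV_I, symmetric]
  obtain B where B: "\<And>x. norm (A x) \<le> B * norm x" using A by (auto simp: bounded_op_def)
  have "norm (adj UNIV A y) \<le> B * norm y" for y
  proof (cases "adj UNIV A y = 0")
    case True
    then show ?thesis using order_trans[OF norm_ge_zero B[of y]] by simp
  next
    case False
    let ?z = "adj UNIV A y"
    have "(norm ?z)\<^sup>2 = cmod (cinner ?z ?z)" by (simp add: cinner_self norm_power)
    also have "\<dots> = cmod (cinner (A ?z) y)" by (simp add: adj)
    also have "\<dots> \<le> norm (A ?z) * norm y" by (rule norm_cinner)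
    also have "\<dots> \<le> B * norm ?z * norm y" by (intro mult_right_mono B) simp
    finally show ?thesis using False by (simp add: power2_eq_square)
  qed
  moreover have "adj UNIV A (x + y) = adj UNIV A x + adj UNIV A y" for x y
    by (rule cinner_left_eqI) (simp add: adj cinner_add_right)
  moreover have "adj UNIV A (c *\<^sub>C x) = c *\<^sub>C adj UNIV A x" for c x
    by (rule cinner_left_eqI) (simp add: adj cinner_scaleC_right)
  ultimately show ?thesis by (auto simp: bounded_op_def)
qed

subsection \<open>Fuglede's theorem\<close>

text \<open>\<open>g t\<close> is \<open>e\<^sup>t\<^sup>A x\<close>, the solution of
  \<open>g' = A g\<close> with \<open>g 0 = x\<close>. The general Banach space matters: below
  \<open>A\<close> is once a skew-adjoint operator on the Hilbert space and once the commutator with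
  it, acting on the space of operators.\<close>

lemma exp_series:
  fixes A :: "'b::banach \<Rightarrow> 'b" and x :: 'b
  defines "g \<equiv> \<lambda>t::real. \<Sum>n. (t ^ n / fact n) *\<^sub>R (A ^^ n) x"
  assumes A: "bounded_linear A"
  shows exp_series_sums: "(\<lambda>n. (t ^ n / fact n) *\<^sub>R (A ^^ n) x) sums g t"
    and exp_series_0: "g 0 = x"
    and exp_series_has_vector_derivative: "(g has_vector_derivative A (g t)) (at t)"
proof -
  obtain K where K: "K \<ge> 0" "\<And>x. norm (A x) \<le> norm x * K"
    using bounded_linear.nonneg_bounded[OF A] by blast
  have pow: "norm ((A ^^ n) x) \<le> K ^ n * norm x" for n
  proof (induction n)
    case (Suc n)
    have "norm ((A ^^ Suc n) x) \<le> norm ((A ^^ n) x) * K" by (simp add: K)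
    also have "\<dots> \<le> K ^ n * norm x * K" using K Suc by (intro mult_right_mono)
    finally show ?case by (simp add: mult_ac)
  qed simp
  define c where "c n t = (t ^ n / fact n) *\<^sub>R (A ^^ n) x" for n and t :: real
  define e where "e r n = inverse (fact n) * (r * K) ^ n * norm x" for r :: real and n
  have c_le: "norm (c n t) \<le> e r n" if "\<bar>t\<bar> \<le> r" for n t r
  proof -
    have "norm (c n t) = inverse (fact n) * \<bar>t\<bar> ^ n * norm ((A ^^ n) x)"
      by (simp add: c_def abs_mult power_abs divide_inverse mult_ac)
    also have "\<dots> \<le> inverse (fact n) * r ^ n * (K ^ n * norm x)"
      using that pow K by (intro mult_mono power_mono) auto
    finally show ?thesis by (simp add: e_def power_mult_distrib mult_ac)
  qed
  have e_summable: "summable (e r)" for r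
    unfolding e_def by (intro summable_mult2 summable_exp)
  have g_sums: "(\<lambda>n. c n t) sums g t" for t
    unfolding g_def c_def[symmetric]
    by (intro summable_sums summable_comparison_test'[OF e_summable[of "\<bar>t\<bar>"], of 0] c_le) simp
  show "(\<lambda>n. (t ^ n / fact n) *\<^sub>R (A ^^ n) x) sums g t"
    using g_sums by (simp add: c_def)
  show "g 0 = x"
  proof -
    have "(\<lambda>n. c n 0) sums (\<Sum>n\<in>{0}. c n 0)"
      by (rule sums_finite) (auto simp: c_def)
    then show ?thesis using sums_unique2[OF g_sums[of 0]] by (simp add: c_def)
  qed
  show "(g has_vector_derivative A (g t)) (at t)"
  proof -
    define r where "r = \<bar>t\<bar> + 1"
    \<comment> \<open>The majorants \<open>e r\<close> hold for \<open>\<bar>s\<bar> \<le> r\<close>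
      only, so termwise differentiation takes place on a ball that contains
      \<open>t\<close>.\<close>
    define S where "S = ball (0::real) r"
    have tS: "t \<in> S" by (simp add: S_def r_def)
    \<comment> \<open>\<open>D 0\<close> vanishes and \<open>D (Suc n) s\<close> is
      \<open>A (c n s)\<close>: the differentiated series is the image of the original one under
      \<open>A\<close>, shifted by one. Its majorant below is shifted in the same way.\<close>
    define D where "D n s = (real n * s ^ (n - 1) / fact n) *\<^sub>R (A ^^ n) x" for n and s :: real
    have D_Suc: "D (Suc n) s = A (c n s)" for n s
    proof -
      have "real (Suc n) * s ^ (Suc n - 1) / fact (Suc n) = s ^ n / fact n"
        by (simp add: field_simps del: of_nat_Suc)
      then show ?thesis using A by (simp add: D_def c_def bounded_linear.linear linear_cmul)
    qed
    have D_sums: "(\<lambda>n. D n s) sums A (g s)" for s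
      using bounded_linear.sums[OF A g_sums[of s]] sums_Suc_iff[of "\<lambda>n. D n s" "A (g s)"]
      by (simp add: D_Suc) (simp add: D_def)
    have "uniform_limit S (\<lambda>n s. \<Sum>i<n. D i s) (\<lambda>s. suminf (\<lambda>i. D i s)) sequentially"
    proof (rule Weierstrass_m_test)
      show "norm (D n s) \<le> (case n of 0 \<Rightarrow> 0 | Suc m \<Rightarrow> e r m * K)" if "s \<in> S" for n s
      proof (cases n)
        case (Suc m)
        have "norm (c m s) \<le> e r m" using that by (intro c_le) (auto simp: S_def)
        then have "norm (c m s) * K \<le> e r m * K" using K by (intro mult_right_mono)
        then show ?thesis using Suc K(2)[of "c m s"] by (simp add: D_Suc)
      qed (simp add: D_def)
      show "summable (\<lambda>n. case n of 0 \<Rightarrow> 0 | Suc m \<Rightarrow> e r m * K)"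
        by (subst summable_Suc_iff[symmetric]) (simp add: e_summable summable_mult2)
    qed
    then have unif: "uniform_limit S (\<lambda>n s. \<Sum>i<n. D i s) (\<lambda>s. A (g s)) sequentially"
      using D_sums by (simp add: sums_iff)
    have "\<exists>h. \<forall>s\<in>S. (\<lambda>n. c n s) sums h s \<and> (h has_derivative (\<lambda>d. d *\<^sub>R A (g s))) (at s within S)"
    proof (rule has_derivative_series)
      show "(c n has_derivative (\<lambda>d. d *\<^sub>R D n s)) (at s within S)" for n s
        unfolding c_def D_def by (auto intro!: derivative_eq_intros simp: fun_eq_iff field_simps)
      show "\<forall>\<^sub>F n in sequentially. \<forall>s\<in>S. \<forall>h. norm ((\<Sum>i<n. h *\<^sub>R D i s) - h *\<^sub>R A (g s)) \<le> \<epsilon> * norm h"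
        if "\<epsilon> > 0" for \<epsilon>
        using uniform_limitD[OF unif that]
      proof eventually_elim
        case (elim n)
        show ?case
        proof (intro ballI allI)
          fix s h :: real assume "s \<in> S"
          with elim have "norm ((\<Sum>i<n. D i s) - A (g s)) \<le> \<epsilon>" by (auto simp: dist_norm less_imp_le)
          then have "norm (h *\<^sub>R ((\<Sum>i<n. D i s) - A (g s))) \<le> \<epsilon> * norm h"
            using mult_left_mono[of "norm ((\<Sum>i<n. D i s) - A (g s))" \<epsilon> "\<bar>h\<bar>"]
            by (simp add: mult.commute[of \<epsilon>])
          then show "norm ((\<Sum>i<n. h *\<^sub>R D i s) - h *\<^sub>R A (g s)) \<le> \<epsilon> * norm h"
            by (simp add: scaleR_right_diff_distrib scaleR_right.sum)
        qed
      qed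
      show "(\<lambda>n. c n t) sums g t" by (rule g_sums)
    qed (use tS in \<open>auto simp: S_def\<close>)
    then obtain h where h: "\<And>s. s \<in> S \<Longrightarrow> (\<lambda>n. c n s) sums h s"
      "\<And>s. s \<in> S \<Longrightarrow> (h has_derivative (\<lambda>d. d *\<^sub>R A (g s))) (at s within S)" by blast
    have "(h has_derivative (\<lambda>d. d *\<^sub>R A (g t))) (at t)"
      using h(2)[OF tS] tS by (simp add: S_def at_within_open[of _ "ball 0 r"])
    moreover have "h s = g s" if "s \<in> S" for s
      using sums_unique2[OF h(1)[OF that] g_sums] .
    ultimately have "(g has_derivative (\<lambda>d. d *\<^sub>R A (g t))) (at t)"
      using tS by (intro has_derivative_transform_within_open[of h _ t UNIV S g]) (auto simp: S_def)
    then show ?thesis by (simp add: has_vector_derivative_def)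
  qed
qed

text \<open>
  Rosenblum's argument: for \<open>Z = z N\<^sup>* - cnj z N\<close> skew-adjoint, \<open>e\<^sup>Z B e\<^sup>-\<^sup>Z\<close> is bounded by the norm of
  \<open>B\<close>; since \<open>N\<close> commutes with \<open>B\<close>, it is the entire function \<open>\<Sum> z\<^sup>n/n! (ad N\<^sup>*)\<^sup>n B\<close> of \<open>z\<close>, and its
  linear coefficient vanishes by Liouville's theorem.
\<close>

theorem fuglede:
  fixes N N' B :: "'a::chilbert_space \<Rightarrow> 'a"
  assumes N: "bounded_op UNIV UNIV N" and N': "bounded_op UNIV UNIV N'"
    and B: "bounded_op UNIV UNIV B"
    and adj: "\<And>x y. cinner (N x) y = cinner x (N' y)"
    and normal: "\<And>x. N (N' x) = N' (N x)"
    and BN: "\<And>x. B (N x) = N (B x)"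
  shows "B (N' x) = N' (B x)"
proof -
  have adj': "cinner (N' x) y = cinner x (N y)" for x y
    using adj[of y x] by (metis cinner_commute)
  have lin: "A (x - y) = A x - A y" "A (r *\<^sub>R x) = r *\<^sub>R A x" "A (c *\<^sub>C x) = c *\<^sub>C A x"
    if "bounded_op UNIV UNIV A" for A :: "'a \<Rightarrow> 'a" and x y r c
    using that bounded_op_bounded_linear[OF that, THEN bounded_linear.linear]
    by (auto simp: bounded_op_def linear_diff linear_cmul)
  \<comment> \<open>The bounded real-linear maps form a Banach space, to which
    \<open>exp_series\<close> applies. Complex homogeneity is not part of that type, and
    \<open>c_scaleC\<close> recovers it for the iterated commutators.\<close>
  define b n' where "b = Blinfun B" and "n' = Blinfun N'"
  have b: "blinfun_apply b = B" and n': "blinfun_apply n' = N'"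
    using B N' by (simp_all add: b_def n'_def bounded_linear_Blinfun_apply bounded_op_bounded_linear)
  define c where "c n = ((\<lambda>X. (n' o\<^sub>L X) - (X o\<^sub>L n')) ^^ n) b" for n
  have c_0: "c 0 = b" by (simp add: c_def)
  have c_Suc: "c (Suc n) x = N' (c n x) - c n (N' x)" for n x
    by (simp add: c_def blinfun.diff_left n')
  have c_scaleC: "c n (a *\<^sub>C x) = a *\<^sub>C c n x" for n a x
  proof (induction n arbitrary: x)
    case (Suc n)
    then show ?case
      by (simp add: c_Suc lin[OF N'] scaleC_diff_right)
  qed (simp add: c_0 b lin[OF B])
  have c_N: "c n (N x) = N (c n x)" for n x
  proof (induction n arbitrary: x)
    case (Suc n)
    then show ?case by (simp add: c_Suc lin[OF N] normal flip: normal)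
  qed (simp add: c_0 b BN)
  \<comment> \<open>Here \<open>w\<close> is \<open>e\<^sup>Z B e\<^sup>-\<^sup>Z x\<close>. Its
    bound does not depend on \<open>z\<close>, because \<open>Z\<close> generates
    isometries.\<close>
  have bound: "\<exists>w. norm w \<le> norm b * norm x \<and> (\<lambda>n. (1 / fact n) *\<^sub>R z ^ n *\<^sub>C c n x) sums w"
    for z x
  proof -
    define Z where "Z = Blinfun (\<lambda>x. z *\<^sub>C N' x - cnj z *\<^sub>C N x)"
    have Z: "Z x = z *\<^sub>C N' x - cnj z *\<^sub>C N x" for x
      unfolding Z_def
      by (subst bounded_linear_Blinfun_apply[OF bounded_linear_sub])
        (rule bounded_linear_compose[OF bounded_linear_scaleC bounded_op_bounded_linear] N N' refl)+
    have skew: "inner (Z p) q = - inner p (Z q)" for p q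
    proof -
      have "cinner (Z p) q = - cinner p (Z q)"
        by (simp add: Z cinner.diff_left cinner.diff_right cinner_scaleC_left cinner_scaleC_right adj adj')
      then have "Re (cinner (Z p) q) = Re (- cinner p (Z q))" by (rule arg_cong)
      then show ?thesis by (simp add: Re_cinner)
    qed
    define ad where "ad X = (Z o\<^sub>L X) - (X o\<^sub>L Z)" for X
    have "bounded_linear ad"
      unfolding ad_def by (intro bounded_linear_intros)
    define V where "V t = (\<Sum>n. (t ^ n / fact n) *\<^sub>R (ad ^^ n) b)" for t :: real
    have V: "(\<lambda>n. (t ^ n / fact n) *\<^sub>R (ad ^^ n) b) sums V t" "V 0 = b"
      "(V has_vector_derivative ad (V t)) (at t)" for t
      unfolding V_def using \<open>bounded_linear ad\<close> exp_series by blast+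
    \<comment> \<open>\<open>u t\<close> is
      \<open>e\<^sup>(\<^sup>t\<^sup>-\<^sup>1\<^sup>)\<^sup>Z p\<close>. Its value is prescribed at
      time 1, where the bound is wanted, and its norm is constant because \<open>Z\<close> is
      skew.\<close>
    have flow: "\<exists>u. u 1 = p \<and> (\<forall>t. (u has_vector_derivative Z (u t)) (at t)) \<and> norm (u 0) = norm p" for p
    proof -
      define U where "U t = (\<Sum>n. (t ^ n / fact n) *\<^sub>R (blinfun_apply Z ^^ n) p)" for t :: real
      note blinfun.bounded_linear_right[of Z]
      then have U: "U 0 = p" "(U has_vector_derivative Z (U t)) (at t)" for t
        unfolding U_def using exp_series(2,3) by blast+
      define u where "u t = U (t - 1)" for t
      have u1: "u 1 = p" by (simp add: u_def U)
      have u': "(u has_vector_derivative Z (u t)) (at t)" for t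
      proof -
        have "((U \<circ> (\<lambda>t. t - 1)) has_vector_derivative 1 *\<^sub>R Z (U (t - 1))) (at t)"
          by (rule vector_diff_chain_at) (auto intro!: derivative_eq_intros U(2))
        then show ?thesis by (simp add: u_def[abs_def] o_def)
      qed
      have "((\<lambda>t. inner (u t) (u t)) has_vector_derivative 0) (at t)" for t
      proof -
        have "((\<lambda>t. inner (u t) (u t)) has_vector_derivative
            inner (u t) (Z (u t)) + inner (Z (u t)) (u t)) (at t)"
          by (intro bounded_bilinear.has_vector_derivative[OF bounded_bilinear_inner] u')
        then show ?thesis by (simp add: skew)
      qed
      then have "inner (u 0) (u 0) = inner (u 1) (u 1)"
        by (intro DERIV_isconst_all) (simp add: has_real_derivative_iff_has_vector_derivative)
      then have "norm (u 0) = norm p" by (simp add: u1 norm_eq_sqrt_inner)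
      then show ?thesis using u1 u' by blast
    qed
    \<comment> \<open>Along two such flows \<open>inner (V t (u t)) (v t)\<close> is constant, as
      the terms from \<open>V' = Z V - V Z\<close> cancel those from \<open>u\<close> and
      \<open>v\<close>. Comparing times 1 and 0 replaces \<open>V 1\<close> by \<open>b\<close>,
      with no product of exponentials to compute.\<close>
    have weak: "\<bar>inner (V 1 p) q\<bar> \<le> norm b * norm p * norm q" for p q
    proof -
      obtain u where u: "u 1 = p" "\<And>t. (u has_vector_derivative Z (u t)) (at t)" "norm (u 0) = norm p"
        using flow by blast
      obtain v where v: "v 1 = q" "\<And>t. (v has_vector_derivative Z (v t)) (at t)" "norm (v 0) = norm q"
        using flow by blast
      have "((\<lambda>t. inner (V t (u t)) (v t)) has_vector_derivative
          inner (V t (u t)) (Z (v t)) + inner (V t (Z (u t)) + ad (V t) (u t)) (v t)) (at t)" for t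
        by (intro bounded_bilinear.has_vector_derivative[OF bounded_bilinear_inner]
            bounded_bilinear.has_vector_derivative[OF bounded_bilinear_blinfun_apply] V u v)
      then have "((\<lambda>t. inner (V t (u t)) (v t)) has_vector_derivative 0) (at t)" for t
        by (simp add: ad_def blinfun.diff_left skew)
      then have "inner (V 1 (u 1)) (v 1) = inner (V 0 (u 0)) (v 0)"
        by (intro DERIV_isconst_all) (simp add: has_real_derivative_iff_has_vector_derivative)
      then have "\<bar>inner (V 1 p) q\<bar> = \<bar>inner (b (u 0)) (v 0)\<bar>" by (simp add: u v V)
      also have "\<dots> \<le> norm (b (u 0)) * norm (v 0)" by (rule Cauchy_Schwarz_ineq2)
      also have "\<dots> \<le> norm b * norm p * norm q"
        using norm_blinfun[of b "u 0"] by (simp add: u v mult_right_mono)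
      finally show ?thesis .
    qed
    have "norm (V 1 x) \<le> norm b * norm x"
    proof (cases "V 1 x = 0")
      case False
      then show ?thesis using weak[of x "V 1 x"]
        by (simp add: power2_norm_eq_inner[symmetric] power2_eq_square)
    qed simp
    \<comment> \<open>Every \<open>c n\<close> commutes with \<open>N\<close>, so the part
      \<open>cnj z N\<close> of \<open>Z\<close> drops out of the commutator. Only powers of
      \<open>z\<close> remain, which makes the bounded function holomorphic.\<close>
    moreover have pow: "(ad ^^ n) b x = z ^ n *\<^sub>C c n x" for n x
    proof (induction n arbitrary: x)
      case (Suc n)
      have "(ad ^^ Suc n) b x = Z (z ^ n *\<^sub>C c n x) - z ^ n *\<^sub>C c n (Z x)"
        by (simp add: ad_def blinfun.diff_left Suc)
      also have "\<dots> = z ^ Suc n *\<^sub>C c (Suc n) x"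
        by (simp add: Z c_Suc blinfun.diff_right c_scaleC c_N lin[OF N] lin[OF N'] scaleC_scaleC
            scaleC_diff_right mult_ac)
      finally show ?case .
    qed (simp add: c_0)
    moreover have "(\<lambda>n. ((1 / fact n) *\<^sub>R (ad ^^ n) b) x) sums V 1 x"
      using bounded_linear.sums[OF blinfun.bounded_linear_left V(1)[of 1]] by simp
    ultimately show ?thesis by (auto simp: blinfun.scaleR_left)
  qed
  have "cinner (c 1 x) y = 0" for y
  proof -
    define a where "a n = cinner (c n x) y / fact n" for n
    define f where "f z = (\<Sum>n. a n * z ^ n)" for z
    have f: "(\<lambda>n. a n * z ^ n) sums f z \<and> cmod (f z) \<le> norm b * norm x * norm y" for z
    proof -
      obtain w where w: "norm w \<le> norm b * norm x" "(\<lambda>n. (1 / fact n) *\<^sub>R z ^ n *\<^sub>C c n x) sums w"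
        using bound by blast
      have "(\<lambda>n. cinner ((1 / fact n) *\<^sub>R z ^ n *\<^sub>C c n x) y) sums cinner w y"
        by (rule bounded_linear.sums[OF cinner.bounded_linear_left w(2)])
      then have "(\<lambda>n. a n * z ^ n) sums cinner w y"
        by (simp add: a_def cinner_scaleR_left cinner_scaleC_left mult_ac)
      moreover have "cmod (cinner w y) \<le> norm b * norm x * norm y"
        using norm_cinner[of w y] mult_right_mono[OF w(1) norm_ge_zero[of y]] by linarith
      ultimately show ?thesis by (auto simp: f_def sums_iff)
    qed
    have der: "(f has_field_derivative (\<Sum>n. diffs a n * z ^ n)) (at z)" for z
      unfolding f_def using f by (intro termdiffs_strong_converges_everywhere) (auto simp: sums_iff)
    then have "f holomorphic_on UNIV" by (auto simp: holomorphic_on_open)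
    moreover have "bounded (range f)" using f by (auto simp: bounded_iff)
    ultimately obtain k where "\<And>z. f z = k"
      using Liouville_theorem[of f] by (auto simp: constant_on_def)
    then have "f = (\<lambda>z. k)" by auto
    then have "(\<Sum>n. diffs a n * 0 ^ n) = 0"
      using der[of 0] by (metis DERIV_const DERIV_unique)
    \<comment> \<open>\<open>diffs a 0\<close> is the linear coefficient \<open>a 1\<close>, hence
      \<open>cinner (c 1 x) y\<close>, where \<open>c 1\<close> is the commutator of
      \<open>N'\<close> and \<open>B\<close>.\<close>
    then have "diffs a 0 = 0"
      by (simp add: powser_zero)
    then show ?thesis by (simp add: diffs_def a_def)
  qed
  then have "cinner (c 1 x) (c 1 x) = 0" by blast
  then have "c 1 x = 0" by (simp add: cinner_self)
  then show ?thesis using c_Suc[of 0 x] by (simp add: c_0 b)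
qed

subsection \<open>Closed ranges and lower bounds\<close>

lemma
  assumes "bounded_op L M A" "closed_csubspace L"
  shows bounded_op_add: "x \<in> L \<Longrightarrow> y \<in> L \<Longrightarrow> A (x + y) = A x + A y"
    and bounded_op_scaleC: "x \<in> L \<Longrightarrow> A (c *\<^sub>C x) = c *\<^sub>C A x"
    and bounded_op_scaleR: "x \<in> L \<Longrightarrow> A (r *\<^sub>R x) = r *\<^sub>R A x"
    and bounded_op_diff: "x \<in> L \<Longrightarrow> y \<in> L \<Longrightarrow> A (x - y) = A x - A y"
    and bounded_op_0: "A 0 = 0"
proof -
  show add: "A (x + y) = A x + A y" if "x \<in> L" "y \<in> L" for x y
    using assms that by (auto simp: bounded_op_def)
  show scaleC: "A (c *\<^sub>C x) = c *\<^sub>C A x" if "x \<in> L" for c x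
    using assms that by (auto simp: bounded_op_def)
  show "A (r *\<^sub>R x) = r *\<^sub>R A x" if "x \<in> L" for r x
    using scaleC[OF that, of "of_real r"] by (simp add: scaleC_of_real)
  show "A (x - y) = A x - A y" if "x \<in> L" "y \<in> L" for x y
    using add[of "x - y" y] that assms(2) by (simp add: closed_csubspace_diff)
  show "A 0 = 0" using add[of 0 0] assms(2) by (simp add: closed_csubspace_0)
qed

lemma bounded_op_tendsto:
  assumes A: "bounded_op L M A" and L: "closed_csubspace L"
    and X: "\<And>n. X n \<in> L" "x \<in> L" "X \<longlonglongrightarrow> x"
  shows "(\<lambda>n. A (X n)) \<longlonglongrightarrow> A x"
proof -
  obtain B where B: "\<And>x. x \<in> L \<Longrightarrow> norm (A x) \<le> B * norm x"
    using A unfolding bounded_op_def by blast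
  have le: "norm (A (X n) - A x) \<le> B * norm (X n - x)" for n
    using B[of "X n - x"] X L by (simp add: closed_csubspace_diff bounded_op_diff[OF A L])
  have "(\<lambda>n. B * norm (X n - x)) \<longlonglongrightarrow> 0"
    by (intro tendsto_mult_right_zero tendsto_norm_zero LIM_zero X(3))
  then have "(\<lambda>n. A (X n) - A x) \<longlonglongrightarrow> 0"
    by (rule Lim_null_comparison[rotated]) (simp add: le)
  then show ?thesis by (rule LIM_zero_cancel)
qed

text \<open>A product of finitely many metric factors has countable neighbourhood bases, so
  sequences suffice. In this form \<open>y\<close> is an arbitrary function: closedness of
  \<open>L\<close> puts the limits into \<open>L\<close>, and values outside \<open>{1..d}\<close>
  do not enter.\<close>

lemma closed_tuple_range_iff:
  assumes L: "closed L" and A: "\<And>k x. k \<in> {1..d} \<Longrightarrow> x \<in> L \<Longrightarrow> A k x \<in> L"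
  shows "closed_tuple_range d L A \<longleftrightarrow>
    (\<forall>X y. (\<forall>n. X n \<in> L) \<longrightarrow> (\<forall>k\<in>{1..d}. (\<lambda>n. A k (X n)) \<longlonglongrightarrow> y k) \<longrightarrow>
       (\<exists>x\<in>L. \<forall>k\<in>{1..d}. A k x = y k))" (is "_ \<longleftrightarrow> ?seq")
proof
  let ?P = "product_topology (\<lambda>k. top_of_set L) {1..d}"
  assume cl: "closed_tuple_range d L A"
  show ?seq
  proof (intro allI impI)
    fix X y assume X: "\<forall>n. X n \<in> L" and y: "\<forall>k\<in>{1..d}. (\<lambda>n. A k (X n)) \<longlonglongrightarrow> y k"
    have yL: "y k \<in> L" if "k \<in> {1..d}" for k
      using closed_sequentially[OF L, of "\<lambda>n. A k (X n)"] A X y that by blast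
    have "restrict y {1..d} \<in> tuple_range d L A"
    proof (rule limitin_closedin)
      show "limitin ?P (\<lambda>n. \<lambda>k\<in>{1..d}. A k (X n)) (restrict y {1..d}) sequentially"
        using X y yL A by (auto simp: limitin_componentwise limitin_subtopology)
    qed (use cl X in \<open>auto simp: closed_tuple_range_def tuple_range_def\<close>)
    then obtain x where "x \<in> L" "restrict y {1..d} = (\<lambda>k\<in>{1..d}. A k x)"
      by (auto simp: tuple_range_def)
    then show "\<exists>x\<in>L. \<forall>k\<in>{1..d}. A k x = y k" by (metis restrict_apply')
  qed
next
  let ?P = "product_topology (\<lambda>k. top_of_set L) {1..d}"
  assume seq: ?seq
  have "?P closure_of tuple_range d L A \<subseteq> tuple_range d L A"
  proof
    fix l assume l: "l \<in> ?P closure_of tuple_range d L A"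
    then have l_mem: "l \<in> PiE {1..d} (\<lambda>k. L)"
      by (simp add: in_closure_of)
    have "\<exists>x\<in>L. \<forall>k\<in>{1..d}. dist (l k) (A k x) < inverse (Suc n)" for n
    proof -
      let ?T = "PiE {1..d} (\<lambda>k. L \<inter> ball (l k) (inverse (Suc n)))"
      have "openin ?P ?T" by (simp add: openin_PiE openin_open_Int)
      moreover have "l \<in> ?T" using l_mem by (auto simp: PiE_iff)
      ultimately obtain f where "f \<in> tuple_range d L A" "f \<in> ?T"
        using l by (auto simp: in_closure_of)
      then show ?thesis by (fastforce simp: tuple_range_def PiE_iff)
    qed
    then obtain X where X: "\<And>n. X n \<in> L"
      "\<And>n k. k \<in> {1..d} \<Longrightarrow> dist (l k) (A k (X n)) < inverse (Suc n)" by metis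
    have "(\<lambda>n. A k (X n)) \<longlonglongrightarrow> l k" if "k \<in> {1..d}" for k
    proof (rule metric_tendsto_imp_tendsto[OF LIMSEQ_inverse_real_of_nat])
      show "\<forall>\<^sub>F n in sequentially. dist (A k (X n)) (l k) \<le> dist (inverse (real (Suc n))) 0"
        using X(2)[OF that] by (auto simp: dist_commute intro!: always_eventually less_imp_le)
    qed
    then obtain x where "x \<in> L" "\<forall>k\<in>{1..d}. A k x = l k" using seq X(1) by blast
    then have "l = (\<lambda>k\<in>{1..d}. A k x)"
      using l_mem by (auto simp: fun_eq_iff PiE_iff extensional_def)
    then show "l \<in> tuple_range d L A" using \<open>x \<in> L\<close> by (auto simp: tuple_range_def)
  qed
  moreover have "tuple_range d L A \<subseteq> topspace ?P"
    using A by (auto simp: tuple_range_def)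
  ultimately show "closed_tuple_range d L A"
    unfolding closed_tuple_range_def by (simp add: closure_of_subset_eq[symmetric])
qed

lemma bounded_below_imp_closed_tuple_range:
  fixes A :: "nat \<Rightarrow> 'a::chilbert_space \<Rightarrow> 'a"
  assumes L: "closed_csubspace L" and A: "bounded_tuple d L A"
    and below: "\<And>x. x \<in> L \<Longrightarrow> norm x \<le> C * (\<Sum>k=1..d. norm (A k x))"
  shows "closed_tuple_range d L A"
proof (subst closed_tuple_range_iff, goal_cases)
  case 3
  show ?case
  proof (intro allI impI)
    fix X y assume X: "\<forall>n. X n \<in> L" and y: "\<forall>k\<in>{1..d}. (\<lambda>n. A k (X n)) \<longlonglongrightarrow> y k"
    have A_op: "bounded_op L L (A k)" if "k \<in> {1..d}" for k
      using A that by (auto simp: bounded_tuple_def)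
    define s where "s m n = C * (\<Sum>k=1..d. norm (A k (X m) - A k (X n)))" for m n
    have le: "norm (X m - X n) \<le> s m n" for m n
      using below[of "X m - X n"] X L
      by (simp add: s_def closed_csubspace_diff bounded_op_diff[OF A_op L])
    have "Cauchy X"
    proof (rule metric_CauchyI)
      fix e :: real assume "e > 0"
      \<comment> \<open>The absolute value and both summands 1 keep the denominator positive when
        \<open>C\<close> is zero or negative and when \<open>d = 0\<close>.\<close>
      define \<epsilon> where "\<epsilon> = e / ((\<bar>C\<bar> + 1) * (real d + 1))"
      have "\<epsilon> > 0" using \<open>e > 0\<close> by (simp add: \<epsilon>_def)
      have "\<exists>M. \<forall>m\<ge>M. \<forall>n\<ge>M. norm (A k (X m) - A k (X n)) < \<epsilon>" if "k \<in> {1..d}" for k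
        using y that \<open>\<epsilon> > 0\<close> LIMSEQ_imp_Cauchy CauchyD by blast
      then obtain M where M: "\<And>k m n. k \<in> {1..d} \<Longrightarrow> m \<ge> M k \<Longrightarrow> n \<ge> M k \<Longrightarrow>
          norm (A k (X m) - A k (X n)) < \<epsilon>" by metis
      have "dist (X m) (X n) < e" if "m \<ge> Max (M ` {1..d})" "n \<ge> Max (M ` {1..d})" for m n
      proof -
        have "norm (A k (X m) - A k (X n)) \<le> \<epsilon>" if "k \<in> {1..d}" for k
        proof -
          have "M k \<le> Max (M ` {1..d})" using that by (intro Max_ge) auto
          then show ?thesis using M[OF that, of m n] \<open>m \<ge> _\<close> \<open>n \<ge> _\<close> by simp
        qed
        then have "(\<Sum>k=1..d. norm (A k (X m) - A k (X n))) \<le> real d * \<epsilon>"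
          using sum_mono[of "{1..d}" _ "\<lambda>_. \<epsilon>"] by simp
        then have "s m n \<le> \<bar>C\<bar> * (real d * \<epsilon>)"
          unfolding s_def by (intro mult_mono) (auto intro: sum_nonneg)
        also have "\<dots> < (\<bar>C\<bar> + 1) * ((real d + 1) * \<epsilon>)"
          by (rule mult_strict_mono) (use \<open>\<epsilon> > 0\<close> in \<open>auto simp: algebra_simps\<close>)
        also have "\<dots> = e" by (simp add: \<epsilon>_def add_eq_0_iff)
        finally show ?thesis using le[of m n] by (simp add: dist_norm)
      qed
      then show "\<exists>M. \<forall>m\<ge>M. \<forall>n\<ge>M. dist (X m) (X n) < e" by blast
    qed
    then obtain x where x: "X \<longlonglongrightarrow> x" using Cauchy_convergent convergent_def by blast
    then have "x \<in> L" using closed_sequentially X L by (metis closed_csubspace_def)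
    moreover have "A k x = y k" if "k \<in> {1..d}" for k
      using bounded_op_tendsto[OF A_op[OF that] L, of X x] X \<open>x \<in> L\<close> x y that LIMSEQ_unique by blast
    ultimately show "\<exists>x\<in>L. \<forall>k\<in>{1..d}. A k x = y k" by blast
  qed
qed (use L A in \<open>auto simp: closed_csubspace_def bounded_tuple_def bounded_op_def\<close>)

text \<open>
  The bounded inverse theorem for the column operator \<open>A\<close>. Closedness of the range makes \<open>L\<close>
  complete for the metric \<open>\<Sum>\<^sub>k \<bar>A\<^sub>k (x - y)\<bar>\<close>, so that Baire's theorem and the usual successive
  approximation apply without leaving \<open>L\<close>.
\<close>

lemma closed_tuple_range_imp_bounded_below:
  fixes A :: "nat \<Rightarrow> 'a::chilbert_space \<Rightarrow> 'a"
  assumes L: "closed_csubspace L" and A: "bounded_tuple d L A"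
    and ker: "tuple_kernel d L A = {0}" and range: "closed_tuple_range d L A"
  obtains C where "C > 0" "\<And>x. x \<in> L \<Longrightarrow> norm x \<le> C * (\<Sum>k=1..d. norm (A k x))"
proof -
  have A_op: "bounded_op L L (A k)" if "k \<in> {1..d}" for k
    using A that by (auto simp: bounded_tuple_def)
  note A_simps = bounded_op_add[OF A_op L] bounded_op_scaleR[OF A_op L] bounded_op_diff[OF A_op L]
  note L_simps = closed_csubspace_0[OF L] closed_csubspace_add[OF L] closed_csubspace_diff[OF L]
    closed_csubspace_scaleR[OF L] closed_csubspace_sum[OF L]
  define p where "p x = (\<Sum>k=1..d. norm (A k x))" for x
  have p_nonneg: "p x \<ge> 0" for x by (simp add: p_def sum_nonneg)
  have p_0: "p 0 = 0" using bounded_op_0[OF A_op L] by (simp add: p_def)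
  have p_eq_0: "x = 0" if "x \<in> L" "p x = 0" for x
    using that ker by (auto simp: p_def tuple_kernel_def sum_nonneg_eq_0_iff)
  have p_diff: "p (x - y) \<le> p x + p y" if "x \<in> L" "y \<in> L" for x y
    using that by (simp add: p_def A_simps norm_triangle_ineq4 sum_mono flip: sum.distrib)
  have p_scale: "p (r *\<^sub>R x) = \<bar>r\<bar> * p x" if "x \<in> L" for r x
    using that by (simp add: p_def A_simps sum_distrib_left)
  have p_commute: "p (x - y) = p (y - x)" if "x \<in> L" "y \<in> L" for x y
    using that by (simp add: p_def A_simps norm_minus_commute)
  \<comment> \<open>The \<open>A k\<close> are linear on \<open>L\<close> only; the value 0
    elsewhere makes symmetry hold for all arguments, as \<open>Metric_space\<close> demands.\<close>
  define \<rho> where "\<rho> x y = (if x \<in> L \<and> y \<in> L then p (x - y) else 0)" for x y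
  interpret Metric_space L \<rho>
  proof
    show "\<rho> x z \<le> \<rho> x y + \<rho> y z" if "x \<in> L" "y \<in> L" "z \<in> L" for x y z
      using p_diff[of "x - y" "z - y"] p_commute[of z y] that by (simp add: \<rho>_def L_simps)
    show "\<rho> x y = 0 \<longleftrightarrow> x = y" if "x \<in> L" "y \<in> L" for x y
      using p_eq_0[of "x - y"] that p_0 by (auto simp: \<rho>_def L_simps)
  qed (auto simp: \<rho>_def p_nonneg p_commute)
  have range_seq: "\<forall>X y. (\<forall>n. X n \<in> L) \<longrightarrow> (\<forall>k\<in>{1..d}. (\<lambda>n. A k (X n)) \<longlonglongrightarrow> y k) \<longrightarrow>
      (\<exists>x\<in>L. \<forall>k\<in>{1..d}. A k x = y k)"
    using range L A_op
    by (subst (asm) closed_tuple_range_iff) (auto simp: closed_csubspace_def bounded_op_def)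
  have "mcomplete"
    unfolding mcomplete_def
  proof (intro allI impI)
    fix \<sigma> assume \<sigma>: "MCauchy \<sigma>"
    then have \<sigma>L: "\<sigma> n \<in> L" for n by (auto simp: MCauchy_def)
    have "\<exists>y. (\<lambda>n. A k (\<sigma> n)) \<longlonglongrightarrow> y" if k: "k \<in> {1..d}" for k
    proof -
      have "Cauchy (\<lambda>n. A k (\<sigma> n))"
      proof (rule metric_CauchyI)
        fix e :: real assume "e > 0"
        then obtain M where M: "\<And>m n. m \<ge> M \<Longrightarrow> n \<ge> M \<Longrightarrow> \<rho> (\<sigma> m) (\<sigma> n) < e"
          using \<sigma> unfolding MCauchy_def by blast
        have "dist (A k (\<sigma> m)) (A k (\<sigma> n)) < e" if "m \<ge> M" "n \<ge> M" for m n
        proof -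
          have "norm (A k (\<sigma> m - \<sigma> n)) \<le> p (\<sigma> m - \<sigma> n)"
            unfolding p_def using k by (intro member_le_sum) auto
          then show ?thesis
            using M[OF that] k \<sigma>L by (simp add: \<rho>_def A_simps dist_norm)
        qed
        then show "\<exists>M. \<forall>m\<ge>M. \<forall>n\<ge>M. dist (A k (\<sigma> m)) (A k (\<sigma> n)) < e" by blast
      qed
      then show ?thesis using Cauchy_convergent convergent_def by blast
    qed
    then obtain y where y: "\<forall>k\<in>{1..d}. (\<lambda>n. A k (\<sigma> n)) \<longlonglongrightarrow> y k" by metis
    then obtain x where x: "x \<in> L" "\<forall>k\<in>{1..d}. A k x = y k"
      using range_seq \<sigma>L by blast
    have "(\<lambda>n. \<Sum>k=1..d. norm (A k (\<sigma> n) - A k x)) \<longlonglongrightarrow> (\<Sum>k=1..d. 0)"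
      using x y by (intro tendsto_sum tendsto_norm_zero LIM_zero) auto
    then have "(\<lambda>n. \<rho> (\<sigma> n) x) \<longlonglongrightarrow> 0"
      using x(1) \<sigma>L by (simp add: \<rho>_def p_def A_simps)
    then show "\<exists>x. limitin mtopology \<sigma> x sequentially"
      using x \<sigma>L by (auto simp: limitin_metric_dist_null)
  qed
  \<comment> \<open>Norm balls, closed up in the metric \<open>\<rho>\<close>, exhaust
    \<open>L\<close>; by Baire one of them contains a \<open>\<rho>\<close>-ball.\<close>
  define F where "F n = mtopology closure_of {x \<in> L. norm x \<le> real n}" for n
  have "\<exists>n. mtopology interior_of F n \<noteq> {}"
  proof (rule ccontr)
    assume "\<not> ?thesis"
    then have "mtopology interior_of \<Union>(range F) = {}"
      using \<open>mcomplete\<close> by (intro metric_Baire_category_alt) (auto simp: F_def)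
    moreover have "\<Union>(range F) = L"
    proof
      show "\<Union>(range F) \<subseteq> L" using closure_of_subset_topspace by (fastforce simp: F_def)
      show "L \<subseteq> \<Union>(range F)"
      proof
        fix x assume "x \<in> L"
        then have "x \<in> F (nat \<lceil>norm x\<rceil>)"
          unfolding F_def by (intro subsetD[OF closure_of_subset]) (auto simp: of_nat_ceiling)
        then show "x \<in> \<Union>(range F)" by blast
      qed
    qed
    ultimately have "L = {}" using interior_of_topspace[of mtopology] by simp
    then show False using L_simps(1) by simp
  qed
  then obtain n x0 \<epsilon> where x0: "x0 \<in> L" "\<epsilon> > 0" "mball x0 \<epsilon> \<subseteq> F n"
    by (auto simp: metric_interior_of)
  \<comment> \<open>The ball found is centred at \<open>x0\<close>. Writing \<open>x\<close> as half
    the difference of \<open>x0 + x\<close> and \<open>x0 - x\<close>, and averaging their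
    approximants likewise, moves the centre to 0 with the same \<open>n\<close>.\<close>
  have near: "\<exists>w\<in>L. norm w \<le> real n \<and> p (x - w) < \<delta>" if x: "x \<in> L" "p x < \<epsilon>" and "\<delta> > 0" for x \<delta>
  proof -
    have ex: "\<exists>w\<in>L. norm w \<le> real n \<and> p (x0 + z - w) < \<delta>" if "z \<in> L" "p z < \<epsilon>" for z
    proof -
      have "x0 + z \<in> mball x0 \<epsilon>"
        using that x0 p_scale[of z "-1"] by (simp add: \<rho>_def L_simps)
      then have "x0 + z \<in> F n" using x0 by blast
      then have "\<exists>w\<in>{x \<in> L. norm x \<le> real n}. w \<in> mball (x0 + z) \<delta>"
        using \<open>\<delta> > 0\<close> unfolding F_def metric_closure_of by blast
      then show ?thesis by (auto simp: \<rho>_def)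
    qed
    obtain w1 where w1: "w1 \<in> L" "norm w1 \<le> real n" "p (x0 + x - w1) < \<delta>" using ex x by blast
    obtain w2 where w2: "w2 \<in> L" "norm w2 \<le> real n" "p (x0 + - x - w2) < \<delta>"
      using ex[of "- x"] x p_scale[of x "-1"] L_simps(4)[of x "-1"] by auto
    let ?w = "(1/2) *\<^sub>R (w1 - w2)"
    have "x - ?w = (1/2) *\<^sub>R ((x0 + x - w1) - (x0 + - x - w2))"
      by (simp add: algebra_simps flip: scaleR_add_left)
    moreover have "p ((x0 + x - w1) - (x0 + - x - w2)) < 2 * \<delta>"
      using p_diff[of "x0 + x - w1" "x0 + - x - w2"] x x0 w1 w2 by (simp add: L_simps)
    moreover have "(x0 + x - w1) - (x0 + - x - w2) \<in> L"
      using x x0 w1 w2 L_simps by (metis diff_conv_add_uminus)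
    ultimately have "p (x - ?w) < \<delta>" by (simp only: p_scale)
    moreover have "norm ?w \<le> real n"
      using norm_triangle_ineq4[of w1 w2] w1 w2 by simp
    ultimately show ?thesis using w1 w2 by (intro bexI[of _ ?w]) (auto simp: L_simps)
  qed
  have near_scaled: "\<exists>w\<in>L. norm w \<le> real n * r \<and> p (x - w) < \<delta>"
    if x: "x \<in> L" "p x < \<epsilon> * r" and "\<delta> > 0" "r > 0" for x \<delta> r
  proof -
    have "p ((1/r) *\<^sub>R x) < \<epsilon>" using x \<open>r > 0\<close> by (simp add: p_scale field_simps)
    then obtain w where w: "w \<in> L" "norm w \<le> real n" "p ((1/r) *\<^sub>R x - w) < \<delta> / r"
      using near[of "(1/r) *\<^sub>R x" "\<delta> / r"] x L_simps(4) \<open>\<delta> > 0\<close> \<open>r > 0\<close> divide_pos_pos by blast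
    have "x - r *\<^sub>R w = r *\<^sub>R ((1/r) *\<^sub>R x - w)" using \<open>r > 0\<close> by (simp add: algebra_simps)
    then have "p (x - r *\<^sub>R w) = \<bar>r\<bar> * p ((1/r) *\<^sub>R x - w)"
      using w(1) x(1) L_simps by (metis p_scale)
    then have "p (x - r *\<^sub>R w) < \<delta>"
      using w \<open>r > 0\<close> by (simp add: field_simps)
    then show ?thesis using w \<open>r > 0\<close> by (intro bexI[of _ "r *\<^sub>R w"]) (auto simp: L_simps)
  qed
  have small: "norm x \<le> 2 * real n" if x: "x \<in> L" "p x < \<epsilon>" for x
  proof -
    define w where "w r x = (SOME w. w \<in> L \<and> norm w \<le> real n * r \<and> p (x - w) < \<epsilon> * (r / 2))" for r x
    have w: "w r x \<in> L \<and> norm (w r x) \<le> real n * r \<and> p (x - w r x) < \<epsilon> * (r / 2)"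
      if "x \<in> L" "p x < \<epsilon> * r" "r > 0" for r x
      unfolding w_def
      by (rule someI_ex) (use near_scaled[of x r "\<epsilon> * (r / 2)"] that x0(2) in \<open>simp add: Bex_def\<close>)
    \<comment> \<open>\<open>xs i\<close> is what remains of \<open>x\<close> after \<open>i\<close>
      corrections. It is less than \<open>\<epsilon> / 2\<^sup>i\<close> in \<open>p\<close>, so the
      next correction \<open>u i\<close> has norm at most \<open>n / 2\<^sup>i\<close>, and the
      norms add up to at most \<open>2 n\<close>.\<close>
    define xs where "xs = rec_nat x (\<lambda>i y. y - w ((1/2) ^ i) y)"
    define u where "u i = w ((1/2) ^ i) (xs i)" for i
    have xs_0: "xs 0 = x" and xs_Suc: "xs (Suc i) = xs i - u i" for i
      by (simp_all add: xs_def u_def)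
    have xs: "xs i \<in> L \<and> p (xs i) < \<epsilon> * (1/2) ^ i" for i
    proof (induction i)
      case (Suc i)
      then show ?case using w[of "xs i" "(1/2) ^ i"] by (simp add: xs_Suc u_def L_simps)
    qed (simp add: xs_0 x)
    have u: "u i \<in> L" "norm (u i) \<le> real n * (1/2) ^ i" for i
      using w[of "xs i" "(1/2) ^ i"] xs[of i] by (auto simp: u_def)
    have geo: "(\<lambda>i. real n * (1/2) ^ i) sums (real n * 2)"
      using sums_mult[OF geometric_sums[of "1/2 :: real"], of "real n"] by simp
    have "summable u"
      by (rule summable_comparison_test'[OF sums_summable[OF geo], of 0]) (rule u(2))
    define s where "s = suminf u"
    have s_lim: "(\<lambda>m. \<Sum>i<m. u i) \<longlonglongrightarrow> s"
      using \<open>summable u\<close> by (simp add: s_def summable_LIMSEQ)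
    have sL: "s \<in> L"
    proof (rule closed_sequentially[OF _ _ s_lim])
      show "closed L" using L by (simp add: closed_csubspace_def)
      show "(\<Sum>i<m. u i) \<in> L" for m using u(1) by (rule L_simps(5))
    qed
    have "norm s \<le> real n * 2"
      unfolding s_def using norm_suminf_le[OF u(2) sums_summable[OF geo]] sums_unique[OF geo] by simp
    have partial: "(\<Sum>i<m. u i) = x - xs m" for m
      by (induction m) (auto simp: xs_0 xs_Suc)
    \<comment> \<open>The corrections converge in norm to \<open>s\<close>, whereas the remainders
      are known to vanish only in \<open>p\<close>. The continuous \<open>A k\<close> reconcile the
      two limits, and the trivial kernel then gives \<open>s = x\<close>.\<close>
    have "A k s = A k x" if k: "k \<in> {1..d}" for k
    proof -
      have "(\<lambda>m. A k (\<Sum>i<m. u i)) \<longlonglongrightarrow> A k s"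
        by (rule bounded_op_tendsto[OF A_op[OF k] L _ sL s_lim]) (simp add: L_simps u)
      moreover have "(\<lambda>m. A k (\<Sum>i<m. u i)) \<longlonglongrightarrow> A k x"
      proof (subst Lim_null, rule Lim_null_comparison)
        have "norm (A k (x - xs m) - A k x) \<le> \<epsilon> * (1/2) ^ m" for m
        proof -
          have "norm (A k (xs m)) \<le> p (xs m)"
            unfolding p_def using k by (intro member_le_sum) auto
          then show ?thesis using xs[of m] x k by (simp add: A_simps)
        qed
        then show "\<forall>\<^sub>F m in sequentially. norm (A k (\<Sum>i<m. u i) - A k x) \<le> \<epsilon> * (1/2) ^ m"
          by (simp add: partial)
        show "(\<lambda>m. \<epsilon> * (1/2) ^ m) \<longlonglongrightarrow> 0"
          by (rule tendsto_mult_right_zero) (simp add: LIMSEQ_realpow_zero)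
      qed
      ultimately show ?thesis by (rule LIMSEQ_unique)
    qed
    then have "p (s - x) = 0" using sL x by (simp add: p_def A_simps)
    then have "s = x" using p_eq_0[of "s - x"] sL x by (simp add: L_simps)
    then show ?thesis using \<open>norm s \<le> _\<close> by simp
  qed
  show ?thesis
  \<comment> \<open>Scaling \<open>x\<close> to \<open>p\<close>-size \<open>\<epsilon> / 2\<close>
    and applying \<open>small\<close> gives the factor \<open>4 n / \<epsilon>\<close>; the summand
    1 makes it positive for \<open>n = 0\<close>.\<close>
  proof (rule that[of "4 * real n / \<epsilon> + 1"])
    show "4 * real n / \<epsilon> + 1 > 0" using x0 by (simp add: add_nonneg_pos)
    fix x assume x: "x \<in> L"
    show "norm x \<le> (4 * real n / \<epsilon> + 1) * (\<Sum>k=1..d. norm (A k x))"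
    proof (cases "p x = 0")
      case True
      then show ?thesis using p_eq_0[OF x] by (simp add: p_def)
    next
      case False
      then have "p x > 0" using p_nonneg[of x] by simp
      then have "norm ((\<epsilon> / (2 * p x)) *\<^sub>R x) \<le> 2 * real n"
        using x x0 by (intro small) (auto simp: L_simps p_scale)
      then have "norm x \<le> 4 * real n / \<epsilon> * p x"
        using \<open>p x > 0\<close> x0 by (simp add: field_simps)
      also have "\<dots> \<le> (4 * real n / \<epsilon> + 1) * p x" using \<open>p x > 0\<close> by (simp add: algebra_simps)
      finally show ?thesis by (simp add: p_def)
    qed
  qed
qed

text \<open>Sums of squares replace sums of norms because they form the quadratic form of
  \<open>\<Sum>\<^sub>k A\<^sub>k\<^sup>*A\<^sub>k\<close>, which can be added along orthogonal
  decompositions. The passage costs a factor \<open>d\<close>, by Cauchy-Schwarz.\<close>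

lemma closed_tuple_range_iff_bounded_below:
  fixes A :: "nat \<Rightarrow> 'a::chilbert_space \<Rightarrow> 'a"
  assumes L: "closed_csubspace L" and A: "bounded_tuple d L A" and ker: "tuple_kernel d L A = {0}"
  shows "closed_tuple_range d L A \<longleftrightarrow>
    (\<exists>C\<ge>0. \<forall>x\<in>L. (norm x)\<^sup>2 \<le> C * (\<Sum>k=1..d. (norm (A k x))\<^sup>2))"
proof
  assume "closed_tuple_range d L A"
  then obtain C where C: "C > 0" "\<And>x. x \<in> L \<Longrightarrow> norm x \<le> C * (\<Sum>k=1..d. norm (A k x))"
    using closed_tuple_range_imp_bounded_below[OF L A ker] by metis
  have "(norm x)\<^sup>2 \<le> C\<^sup>2 * real d * (\<Sum>k=1..d. (norm (A k x))\<^sup>2)" if "x \<in> L" for x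
  proof -
    have "(norm x)\<^sup>2 \<le> (C * (\<Sum>k=1..d. norm (A k x)))\<^sup>2"
      using C(2)[OF that] by (intro power_mono) auto
    also have "\<dots> = C\<^sup>2 * (\<Sum>k=1..d. norm (A k x))\<^sup>2" by (simp add: power_mult_distrib)
    also have "\<dots> \<le> C\<^sup>2 * ((\<Sum>k=1..d. (norm (A k x))\<^sup>2) * real (card {1..d}))"
      by (intro mult_left_mono sum_squared_le_sum_of_squares) auto
    finally show ?thesis by (simp add: mult_ac)
  qed
  then show "\<exists>C\<ge>0. \<forall>x\<in>L. (norm x)\<^sup>2 \<le> C * (\<Sum>k=1..d. (norm (A k x))\<^sup>2)"
    by (intro exI[of _ "C\<^sup>2 * real d"]) auto
next
  assume "\<exists>C\<ge>0. \<forall>x\<in>L. (norm x)\<^sup>2 \<le> C * (\<Sum>k=1..d. (norm (A k x))\<^sup>2)"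
  then obtain C where C: "C \<ge> 0" "\<And>x. x \<in> L \<Longrightarrow> (norm x)\<^sup>2 \<le> C * (\<Sum>k=1..d. (norm (A k x))\<^sup>2)"
    by blast
  show "closed_tuple_range d L A"
  proof (rule bounded_below_imp_closed_tuple_range[OF L A])
    fix x assume "x \<in> L"
    have sq: "(\<Sum>k=1..d. (norm (A k x))\<^sup>2) \<le> (\<Sum>k=1..d. norm (A k x))\<^sup>2"
    proof (induction d)
      case (Suc n)
      have "0 \<le> (\<Sum>k=1..n. norm (A k x)) * norm (A (Suc n) x)" by (simp add: sum_nonneg)
      then show ?case using Suc by (simp add: power2_sum)
    qed simp
    have "(norm x)\<^sup>2 \<le> C * (\<Sum>k=1..d. (norm (A k x))\<^sup>2)" using C \<open>x \<in> L\<close> by blast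
    also have "\<dots> \<le> C * (\<Sum>k=1..d. norm (A k x))\<^sup>2" using C by (intro mult_left_mono sq)
    finally have "(norm x)\<^sup>2 \<le> (sqrt C * (\<Sum>k=1..d. norm (A k x)))\<^sup>2"
      using C by (simp add: power_mult_distrib)
    then show "norm x \<le> sqrt C * (\<Sum>k=1..d. norm (A k x))"
      by (rule power2_le_imp_le) (simp add: sum_nonneg C)
  qed
qed

subsection \<open>The Koszul complex\<close>

definition koszul_sign :: "nat set \<Rightarrow> nat \<Rightarrow> real" where
  "koszul_sign J k = (- 1) ^ card {j \<in> J. j < k}"

lemma koszul_diff_sign:
  "koszul_diff d A f J =
    (if J \<subseteq> {1..d} then \<Sum>k\<in>J. koszul_sign J k *\<^sub>R A k (f (J - {k})) else 0)"
  by (simp add: koszul_diff_def koszul_sign_def)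

lemma koszul_sign_square: "koszul_sign J k * koszul_sign J k = 1"
  by (simp add: koszul_sign_def flip: power_add mult_2)

lemma koszul_sign_remove:
  assumes "finite J" "k \<in> J"
  shows "koszul_sign (J - {k}) l = (if k < l then - koszul_sign J l else koszul_sign J l)"
proof (cases "k < l")
  case True
  have "card {j \<in> J. j < l} = Suc (card ({j \<in> J. j < l} - {k}))"
    using assms True by (intro card.remove) auto
  moreover have "{j \<in> J. j < l} - {k} = {j \<in> J - {k}. j < l}" by auto
  ultimately show ?thesis using True by (simp add: koszul_sign_def)
next
  case False
  then have "{j \<in> J - {k}. j < l} = {j \<in> J. j < l}" by auto
  then show ?thesis using False by (simp add: koszul_sign_def)
qed

lemma koszul_sign_insert:
  assumes "finite J" "l \<notin> J"
  shows "koszul_sign (insert l J) k = (if l < k then - koszul_sign J k else koszul_sign J k)"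
  using koszul_sign_remove[of "insert l J" l k] assms by auto

lemma koszul_sign_singleton: "koszul_sign {k} k = 1"
proof -
  have "{j \<in> {k}. j < k} = {}" by auto
  then show ?thesis unfolding koszul_sign_def by (metis card.empty power_0)
qed

lemma koszul_diff_zero:
  assumes "\<And>k. k \<in> {1..d} \<Longrightarrow> A k 0 = 0"
  shows "koszul_diff d A (\<lambda>_. 0) = (\<lambda>_. 0)"
  using assms by (auto simp: koszul_diff_sign fun_eq_iff intro!: sum.neutral)

text \<open>The terms of the ordered pairs \<open>(k, l)\<close> and \<open>(l, k)\<close> cancel:
  the operators commute, and of \<open>k < l\<close> and \<open>l < k\<close> exactly one holds, so
  removing the first index flips exactly one of the two signs.\<close>

lemma koszul_diff_koszul_diff:
  fixes A :: "nat \<Rightarrow> 'a::complex_inner \<Rightarrow> 'a"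
  assumes A: "\<And>k. k \<in> {1..d} \<Longrightarrow> bounded_linear (A k)"
    and comm: "\<And>i j x. i \<in> {1..d} \<Longrightarrow> j \<in> {1..d} \<Longrightarrow> A i (A j x) = A j (A i x)"
  shows "koszul_diff d A (koszul_diff d A f) = (\<lambda>_. 0)"
proof
  fix J
  show "koszul_diff d A (koszul_diff d A f) J = 0"
  proof (cases "J \<subseteq> {1..d}")
    case J: True
    then have "finite J" by (rule finite_subset) simp
    define F where "F k l = (koszul_sign J k * koszul_sign (J - {k}) l) *\<^sub>R A k (A l (f (J - {k} - {l})))" for k l
    have anti: "F l k = - F k l" if "k \<in> J" "l \<in> J" "k \<noteq> l" for k l
    proof -
      have "koszul_sign J l * koszul_sign (J - {l}) k = - (koszul_sign J k * koszul_sign (J - {k}) l)"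
        using that \<open>finite J\<close> by (auto simp: koszul_sign_remove)
      moreover have "J - {l} - {k} = J - {k} - {l}" by auto
      ultimately show ?thesis using that J comm[of k l] by (auto simp: F_def subset_iff)
    qed
    define P where "P = {(k, l) \<in> J \<times> J. k \<noteq> l}"
    have "koszul_diff d A (koszul_diff d A f) J = (\<Sum>k\<in>J. \<Sum>l\<in>J-{k}. F k l)"
      using J A by (auto simp: koszul_diff_sign F_def bounded_linear.linear linear_sum linear_cmul
          scaleR_sum_right subset_iff intro!: sum.cong)
    also have "\<dots> = (\<Sum>(k, l)\<in>P. F k l)"
      using \<open>finite J\<close> by (subst sum.Sigma) (auto simp: P_def intro!: sum.cong)
    finally have S: "koszul_diff d A (koszul_diff d A f) J = (\<Sum>(k, l)\<in>P. F k l)" .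
    have "(\<Sum>(k, l)\<in>P. F k l) = (\<Sum>(k, l)\<in>P. F l k)"
      by (rule sum.reindex_bij_witness[of _ prod.swap prod.swap]) (auto simp: P_def)
    also have "\<dots> = (\<Sum>(k, l)\<in>P. - F k l)"
      by (intro sum.cong) (auto simp: P_def intro!: anti)
    also have "\<dots> = - (\<Sum>(k, l)\<in>P. F k l)"
      by (simp add: sum_negf split_def)
    finally have "2 *\<^sub>R (\<Sum>(k, l)\<in>P. F k l) = 0"
      unfolding eq_neg_iff_add_eq_0 scaleR_2 .
    then show ?thesis unfolding S by simp
  qed (simp add: koszul_diff_sign)
qed

lemma koszul_diff_mem:
  assumes A: "\<And>k. k \<in> {1..d} \<Longrightarrow> A k 0 = 0" and f: "f \<in> koszul_space d UNIV p"
  shows "koszul_diff d A f \<in> koszul_space d UNIV (Suc p)"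
proof -
  have "koszul_diff d A f J = 0" if J: "J \<subseteq> {1..d}" "card J \<noteq> Suc p" for J
  proof -
    have "f (J - {k}) = 0" if "k \<in> J" for k
    proof -
      have "finite J" using J by (auto intro: finite_subset)
      then have "card J = Suc (card (J - {k}))" using that by (rule card.remove)
      then show ?thesis using J f by (auto simp: koszul_space_def)
    qed
    then show ?thesis using J A by (auto simp: koszul_diff_sign subset_iff intro!: sum.neutral)
  qed
  then show ?thesis by (auto simp: koszul_space_def koszul_diff_sign)
qed

text \<open>Contraction by the \<open>B l\<close>; for \<open>B l\<close> the adjoint of
  \<open>A l\<close> this is the adjoint of \<open>koszul_diff\<close>. The sign agrees with that of
  \<open>l\<close> in \<open>insert l I\<close>, since \<open>l\<close> does not count below
  itself.\<close>

definition koszul_codiff ::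
  "nat \<Rightarrow> (nat \<Rightarrow> 'a \<Rightarrow> 'a) \<Rightarrow> (nat set \<Rightarrow> 'a) \<Rightarrow> nat set \<Rightarrow> 'a::complex_inner" where
  "koszul_codiff d B f I =
     (if I \<subseteq> {1..d}
      then \<Sum>l\<in>{1..d} - I. koszul_sign I l *\<^sub>R B l (f (insert l I))
      else 0)"

text \<open>The terms that remove and reinsert the same index give \<open>B k (A k (f J))\<close>,
  for \<open>k\<close> in \<open>J\<close> from the first composite and for \<open>k\<close> outside
  \<open>J\<close> from the second. The mixed terms \<open>F k l\<close>, which exchange
  \<open>k\<close> in \<open>J\<close> for \<open>l\<close> outside, occur in both with opposite
  signs.\<close>

lemma koszul_homotopy:
  fixes A B :: "nat \<Rightarrow> 'a::complex_inner \<Rightarrow> 'a"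
  assumes A: "\<And>k. k \<in> {1..d} \<Longrightarrow> bounded_linear (A k)"
    and B: "\<And>k. k \<in> {1..d} \<Longrightarrow> bounded_linear (B k)"
    and comm: "\<And>i j x. i \<in> {1..d} \<Longrightarrow> j \<in> {1..d} \<Longrightarrow> A i (B j x) = B j (A i x)"
    and J: "J \<subseteq> {1..d}"
  shows "koszul_diff d A (koszul_codiff d B f) J + koszul_codiff d B (koszul_diff d A f) J =
    (\<Sum>k=1..d. B k (A k (f J)))"
proof -
  have "finite J" using J by (rule finite_subset) simp
  define F where "F k l = (koszul_sign J k * koszul_sign (J - {k}) l) *\<^sub>R B l (A k (f (insert l (J - {k}))))" for k l
  have "koszul_diff d A (koszul_codiff d B f) J = (\<Sum>k\<in>J. B k (A k (f J)) + (\<Sum>l\<in>{1..d} - J. F k l))"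
    unfolding koszul_diff_sign if_P[OF J]
  proof (intro sum.cong refl)
    fix k assume k: "k \<in> J"
    have "{1..d} - (J - {k}) = insert k ({1..d} - J)" using k J by auto
    then have "koszul_codiff d B f (J - {k}) = koszul_sign (J - {k}) k *\<^sub>R B k (f J) +
        (\<Sum>l\<in>{1..d} - J. koszul_sign (J - {k}) l *\<^sub>R B l (f (insert l (J - {k}))))"
      using k J by (auto simp: koszul_codiff_def insert_absorb)
    moreover have "koszul_sign (J - {k}) k = koszul_sign J k" using k \<open>finite J\<close> by (simp add: koszul_sign_remove)
    moreover have "bounded_linear (A k)" using A k J by auto
    ultimately show "koszul_sign J k *\<^sub>R A k (koszul_codiff d B f (J - {k})) =
        B k (A k (f J)) + (\<Sum>l\<in>{1..d} - J. F k l)"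
      using k J koszul_sign_square[of J k] comm[of k]
      by (auto simp: F_def bounded_linear.linear linear_add linear_sum linear_cmul scaleR_sum_right
          scaleR_add_right subset_iff intro!: sum.cong)
  qed
  moreover have "koszul_codiff d B (koszul_diff d A f) J =
      (\<Sum>l\<in>{1..d} - J. B l (A l (f J)) + (\<Sum>k\<in>J. - F k l))"
    unfolding koszul_codiff_def if_P[OF J]
  proof (intro sum.cong refl)
    fix l assume l: "l \<in> {1..d} - J"
    have "koszul_diff d A f (insert l J) = koszul_sign (insert l J) l *\<^sub>R A l (f J) +
        (\<Sum>k\<in>J. koszul_sign (insert l J) k *\<^sub>R A k (f (insert l (J - {k}))))"
    proof -
      have "insert l J - {k} = insert l (J - {k})" if "k \<in> J" for k using l that by auto
      then show ?thesis
        using l J \<open>finite J\<close> by (simp add: koszul_diff_sign)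
    qed
    moreover have "koszul_sign (insert l J) l = koszul_sign J l"
      using l \<open>finite J\<close> by (simp add: koszul_sign_insert)
    moreover have "koszul_sign J l * koszul_sign (insert l J) k = - (koszul_sign J k * koszul_sign (J - {k}) l)" if "k \<in> J" for k
      using l that \<open>finite J\<close>
      by (auto simp: koszul_sign_insert koszul_sign_remove)
    moreover have "bounded_linear (B l)" using B l by auto
    ultimately show "koszul_sign J l *\<^sub>R B l (koszul_diff d A f (insert l J)) =
        B l (A l (f J)) + (\<Sum>k\<in>J. - F k l)"
      using koszul_sign_square[of J l]
      by (simp add: F_def bounded_linear.linear linear_add linear_sum linear_cmul scaleR_sum_right
          scaleR_add_right)
  qed
  moreover have "(\<Sum>k\<in>J. \<Sum>l\<in>{1..d} - J. F k l) = (\<Sum>l\<in>{1..d} - J. \<Sum>k\<in>J. F k l)"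
    by (rule sum.swap)
  moreover have "(\<Sum>k=1..d. B k (A k (f J))) =
      (\<Sum>k\<in>J. B k (A k (f J))) + (\<Sum>k\<in>{1..d} - J. B k (A k (f J)))"
    using J by (simp add: sum.subset_diff add.commute)
  ultimately show ?thesis by (simp add: sum.distrib sum_negf sum_subtractf)
qed

text \<open>The sum of the \<open>B k A k\<close> commutes with every \<open>A k\<close>, so its
  inverse maps cocycles coefficientwise to cocycles. For the image \<open>h\<close> of a cocycle
  \<open>f\<close> one term of the homotopy formula vanishes, and the other says that
  \<open>koszul_codiff d B h\<close> is a primitive of \<open>f\<close>.\<close>

lemma koszul_exactI:
  fixes A B :: "nat \<Rightarrow> 'a::complex_inner \<Rightarrow> 'a"
  assumes A: "\<And>k. k \<in> {1..d} \<Longrightarrow> bounded_linear (A k)"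
    and B: "\<And>k. k \<in> {1..d} \<Longrightarrow> bounded_linear (B k)"
    and A_comm: "\<And>i j x. i \<in> {1..d} \<Longrightarrow> j \<in> {1..d} \<Longrightarrow> A i (A j x) = A j (A i x)"
    and AB_comm: "\<And>i j x. i \<in> {1..d} \<Longrightarrow> j \<in> {1..d} \<Longrightarrow> A i (B j x) = B j (A i x)"
    and bij: "bij (\<lambda>x. \<Sum>k=1..d. B k (A k x))"
  shows "koszul_exact d UNIV A"
proof -
  define P where "P x = (\<Sum>k=1..d. B k (A k x))" for x
  have A0: "A k 0 = 0" and B0: "B k 0 = 0" if "k \<in> {1..d}" for k
    using A B that by (simp_all add: bounded_linear.linear linear_0)
  have P0: "P 0 = 0" using A0 B0 by (simp add: P_def)
  have P_eq_0: "x = 0" if "P x = 0" for x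
    using bij that P0 unfolding bij_def P_def[symmetric] by (metis injD)
  have P_A: "P (A k x) = A k (P x)" if "k \<in> {1..d}" for k x
    using that A A_comm AB_comm by (simp add: P_def bounded_linear.linear linear_sum)
  have lin_P: "linear P"
    by (rule linearI)
      (use A B in \<open>simp_all add: P_def bounded_linear.linear linear_add linear_cmul
        sum.distrib scaleR_sum_right\<close>)
  have "{f \<in> koszul_space d UNIV 0. koszul_diff d A f = (\<lambda>_. 0)} = {\<lambda>_. 0}"
  proof (intro equalityI subsetI)
    fix f assume "f \<in> {f \<in> koszul_space d UNIV 0. koszul_diff d A f = (\<lambda>_. 0)}"
    then have f: "f \<in> koszul_space d UNIV 0" and df: "koszul_diff d A f = (\<lambda>_. 0)" by auto
    have "A k (f {}) = 0" if "k \<in> {1..d}" for k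
      using fun_cong[OF df, of "{k}"] that by (simp add: koszul_diff_sign koszul_sign_singleton)
    then have "P (f {}) = 0" using B0 by (simp add: P_def)
    then have "f {} = 0" by (rule P_eq_0)
    moreover have "f I = 0" if "I \<noteq> {}" for I
    proof -
      have "\<not> (I \<subseteq> {1..d} \<and> card I = 0)" using that by (auto dest: finite_subset)
      then show ?thesis using f by (auto simp: koszul_space_def)
    qed
    ultimately have "f I = 0" for I by (cases "I = {}") auto
    then show "f \<in> {\<lambda>_. 0}" by auto
  qed (use koszul_diff_zero[of d A] A0 in \<open>auto simp: koszul_space_def\<close>)
  moreover have "{f \<in> koszul_space d UNIV (Suc p). koszul_diff d A f = (\<lambda>_. 0)} =
      koszul_diff d A ` koszul_space d UNIV p" for p
  proof (intro equalityI subsetI)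
    fix f assume "f \<in> koszul_diff d A ` koszul_space d UNIV p"
    then show "f \<in> {f \<in> koszul_space d UNIV (Suc p). koszul_diff d A f = (\<lambda>_. 0)}"
      using koszul_diff_mem[of d A] koszul_diff_koszul_diff[of d A] A A0 A_comm by auto
  next
    fix f assume "f \<in> {f \<in> koszul_space d UNIV (Suc p). koszul_diff d A f = (\<lambda>_. 0)}"
    then have f: "f \<in> koszul_space d UNIV (Suc p)" and df: "koszul_diff d A f = (\<lambda>_. 0)" by auto
    define h where "h I = inv P (f I)" for I
    have Ph: "P (h I) = f I" for I
      using bij unfolding h_def P_def[symmetric] by (simp add: bij_is_surj surj_f_inv_f)
    then have h0: "h I = 0" if "f I = 0" for I using that P_eq_0 by metis
    have dh: "koszul_diff d A h = (\<lambda>_. 0)"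
    proof
      fix J
      have "P (koszul_diff d A h J) = koszul_diff d A f J"
        by (auto simp: koszul_diff_sign lin_P linear_sum linear_cmul linear_0 P_A Ph subset_iff
            intro!: sum.cong)
      then show "koszul_diff d A h J = 0" using df P_eq_0 by simp
    qed
    define g where "g = koszul_codiff d B h"
    have "g I = 0" if I: "I \<subseteq> {1..d}" "card I \<noteq> p" for I
    proof -
      have "h (insert l I) = 0" if "l \<in> {1..d} - I" for l
        using that I f finite_subset[OF I(1)] by (intro h0) (auto simp: koszul_space_def)
      then show ?thesis using I B0 by (auto simp: g_def koszul_codiff_def intro!: sum.neutral)
    qed
    then have "g \<in> koszul_space d UNIV p"
      by (auto simp: koszul_space_def g_def koszul_codiff_def)
    moreover have "koszul_diff d A g = f"
    proof
      fix J
      show "koszul_diff d A g J = f J"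
      proof (cases "J \<subseteq> {1..d}")
        case True
        have "koszul_codiff d B (koszul_diff d A h) J = 0"
          unfolding dh using B0 by (auto simp: koszul_codiff_def intro!: sum.neutral)
        then show ?thesis
          using koszul_homotopy[of d A B J h] A B AB_comm True Ph[of J] by (simp add: g_def P_def)
      next
        case False
        then have "\<not> (J \<subseteq> {1..d} \<and> card J = Suc p)" by simp
        then show ?thesis using f False by (auto simp: koszul_space_def koszul_diff_sign)
      qed
    qed
    ultimately show "f \<in> koszul_diff d A ` koszul_space d UNIV p" by blast
  qed
  ultimately show ?thesis by (simp add: koszul_exact_def)
qed

text \<open>In degree one the boundaries are the range of the column operator, and by exactness they
  are the cocycles, which are stable under limits.\<close>

lemma koszul_exact_imp_closed_tuple_range:
  fixes A :: "nat \<Rightarrow> 'a::complex_inner \<Rightarrow> 'a"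
  assumes A: "\<And>k. k \<in> {1..d} \<Longrightarrow> bounded_linear (A k)"
    and comm: "\<And>i j x. i \<in> {1..d} \<Longrightarrow> j \<in> {1..d} \<Longrightarrow> A i (A j x) = A j (A i x)"
    and exact: "koszul_exact d UNIV A"
  shows "closed_tuple_range d UNIV A"
\<comment> \<open>For \<open>d = 0\<close> there is no degree one, but the range is a single
  point.\<close>
proof (cases "d = 0")
  case True
  then show ?thesis by (subst closed_tuple_range_iff) auto
next
  case False
  have A0: "A k 0 = 0" if "k \<in> {1..d}" for k
    using A that by (simp add: bounded_linear.linear linear_0)
  have "\<exists>x. \<forall>k\<in>{1..d}. A k x = y k" if y: "\<forall>k\<in>{1..d}. (\<lambda>n. A k (X n)) \<longlonglongrightarrow> y k" for X y
  proof -
    \<comment> \<open>\<open>F z\<close> is the tuple \<open>z\<close> as an element of degree one,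
      with its entries at the singletons.\<close>
    define F where "F z J = (if J \<subseteq> {1..d} \<and> card J = 1 then z (the_elem J) else 0)"
      for z :: "nat \<Rightarrow> 'a" and J :: "nat set"
    have F_diff: "koszul_diff d A (\<lambda>I. if I = {} then x else 0) = F (\<lambda>k. A k x)" for x
    proof
      fix J
      show "koszul_diff d A (\<lambda>I. if I = {} then x else 0) J = F (\<lambda>k. A k x) J"
      proof (cases "J \<subseteq> {1..d} \<and> card J = 1")
        case True
        then obtain k where "J = {k}" by (auto simp: card_1_singleton_iff)
        then show ?thesis using True by (auto simp: F_def koszul_diff_sign koszul_sign_singleton)
      next
        case False
        show ?thesis
        proof (cases "J \<subseteq> {1..d}")
          case J: True
          have "A k (if J - {k} = {} then x else 0) = 0" if "k \<in> J" for k
          proof -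
            have "J - {k} \<noteq> {}" using False J that by (auto simp: subset_singleton_iff)
            then show ?thesis unfolding if_not_P[OF \<open>J - {k} \<noteq> {}\<close>] using A0 J that by blast
          qed
          then have "koszul_diff d A (\<lambda>I. if I = {} then x else 0) J = 0"
            unfolding koszul_diff_sign if_P[OF J] by (intro sum.neutral ballI) (simp only: scaleR_zero_right)
          then show ?thesis unfolding F_def if_not_P[OF False] .
        qed (simp add: F_def koszul_diff_sign)
      qed
    qed
    have "koszul_diff d A (F y) = (\<lambda>_. 0)"
    proof
      fix J
      show "koszul_diff d A (F y) J = 0"
      proof (cases "J \<subseteq> {1..d}")
        case J: True
        have "(\<lambda>n. F (\<lambda>k. A k (X n)) I) \<longlonglongrightarrow> F y I" for I
        proof (cases "I \<subseteq> {1..d} \<and> card I = 1")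
          case True
          then obtain k where "I = {k}" by (auto simp: card_1_singleton_iff)
          then show ?thesis using True y by (auto simp: F_def)
        next
          case False
          show ?thesis unfolding F_def if_not_P[OF False] by (rule tendsto_const)
        qed
        then have "(\<lambda>n. koszul_diff d A (F (\<lambda>k. A k (X n))) J) \<longlonglongrightarrow> koszul_diff d A (F y) J"
          using J A unfolding koszul_diff_sign if_P[OF J]
          by (intro tendsto_sum tendsto_scaleR tendsto_const bounded_linear.tendsto[of "A _"]) auto
        moreover have "koszul_diff d A (F (\<lambda>k. A k (X n))) = (\<lambda>_. 0)" for n
          unfolding F_diff[symmetric] using A comm by (rule koszul_diff_koszul_diff)
        ultimately show ?thesis by (simp add: LIMSEQ_const_iff)
      qed (simp add: koszul_diff_sign)
    qed
    moreover have "F y \<in> koszul_space d UNIV (Suc 0)" by (auto simp: koszul_space_def F_def)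
    ultimately obtain g where g: "F y = koszul_diff d A g"
      using exact False unfolding koszul_exact_def by blast
    have "A k (g {}) = y k" if "k \<in> {1..d}" for k
      using fun_cong[OF g, of "{k}"] that by (simp add: F_def koszul_diff_sign koszul_sign_singleton)
    then show ?thesis by blast
  qed
  then show ?thesis by (subst closed_tuple_range_iff) auto
qed

subsection \<open>Normal tuples and minimal normal extensions\<close>

context
  fixes d :: nat and N :: "nat \<Rightarrow> 'a::chilbert_space \<Rightarrow> 'a"
  assumes normal: "normal_tuple d UNIV N"
begin

lemma normal_tuple_op:
  assumes "k \<in> {1..d}"
  shows "bounded_op UNIV UNIV (N k)"
  using normal assms by (simp add: normal_tuple_def bounded_tuple_def)

lemma normal_tuple_bounded_linear:
  assumes "k \<in> {1..d}"
  shows "bounded_linear (N k)" "bounded_linear (adj UNIV (N k))"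
  using assms by (simp_all only: bounded_op_bounded_linear bounded_op_adj normal_tuple_op)

lemma normal_tuple_commute:
  assumes "i \<in> {1..d}" "j \<in> {1..d}"
  shows "N i (N j x) = N j (N i x)"
  using normal assms unfolding normal_tuple_def commuting_tuple_def by blast

lemma normal_tuple_cinner_adj:
  assumes "k \<in> {1..d}"
  shows "cinner (N k x) y = cinner x (adj UNIV (N k) y)"
    and "cinner (adj UNIV (N k) x) y = cinner x (N k y)"
  using cinner_adj[OF closed_csubspace_UNIV normal_tuple_op[OF assms]]
  by (auto, metis cinner_commute)

lemma normal_tuple_adj_commute:
  assumes "i \<in> {1..d}" "j \<in> {1..d}"
  shows "N i (adj UNIV (N j) x) = adj UNIV (N j) (N i x)"
proof (rule fuglede[of "N j"])
  show "N j (adj UNIV (N j) x) = adj UNIV (N j) (N j x)" for x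
    using normal assms by (simp add: normal_tuple_def)
qed (simp_all only: assms normal_tuple_op bounded_op_adj normal_tuple_commute normal_tuple_cinner_adj)

lemma norm_adj_normal_tuple:
  assumes "k \<in> {1..d}"
  shows "norm (adj UNIV (N k) x) = norm (N k x)"
proof -
  have "cinner (adj UNIV (N k) x) (adj UNIV (N k) x) = cinner (N k x) (N k x)"
    using assms by (simp add: normal_tuple_cinner_adj normal_tuple_adj_commute)
  then have "(norm (adj UNIV (N k) x))\<^sup>2 = (norm (N k x))\<^sup>2"
    by (simp only: cinner_self of_real_eq_iff)
  then show ?thesis by simp
qed

definition gram :: "'a \<Rightarrow> 'a" where
  "gram x = (\<Sum>k=1..d. adj UNIV (N k) (N k x))"

lemma cinner_gram: "cinner (gram x) y = (\<Sum>k=1..d. cinner (N k x) (N k y))"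
  unfolding gram_def cinner.sum_left by (intro sum.cong refl normal_tuple_cinner_adj)

lemma cinner_gram_right: "cinner x (gram y) = cinner (gram x) y"
  unfolding cinner_gram unfolding gram_def cinner.sum_right
  by (intro sum.cong refl normal_tuple_cinner_adj[symmetric])

lemma bounded_op_gram: "bounded_op UNIV UNIV gram"
proof -
  have "bounded_linear gram"
    unfolding gram_def
    by (intro bounded_linear_sum bounded_linear_compose[OF normal_tuple_bounded_linear(2)]
        normal_tuple_bounded_linear(1))
  moreover have "gram (c *\<^sub>C x) = c *\<^sub>C gram x" for c x
    by (rule cinner_left_eqI) (simp add: cinner_gram_right cinner_scaleC_right)
  ultimately show ?thesis
    using bounded_linear.bounded[of gram]
    by (auto simp: bounded_op_def bounded_linear.linear linear_add mult.commute)
qed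

lemma gram_commute:
  assumes "k \<in> {1..d}"
  shows "gram (N k x) = N k (gram x)"
proof -
  have "linear (N k)" using assms by (intro bounded_linear.linear normal_tuple_bounded_linear)
  then show ?thesis
    unfolding gram_def linear_sum[OF \<open>linear (N k)\<close>] using assms
    by (intro sum.cong refl) (simp add: normal_tuple_adj_commute normal_tuple_commute)
qed

lemma Re_cinner_gram: "Re (cinner (gram x) x) = (\<Sum>k=1..d. (norm (N k x))\<^sup>2)"
  by (simp add: cinner_gram cinner_self)

text \<open>The lower bound for the quadratic form gives one for \<open>gram\<close>, hence
  injectivity and a closed range; self-adjointness identifies the orthogonal complement of the range
  with the kernel.\<close>

lemma bij_gram:
  assumes ker: "tuple_kernel d UNIV N = {0}" and range: "closed_tuple_range d UNIV N"
  shows "bij gram"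
proof -
  have N: "bounded_tuple d UNIV N" using normal by (simp add: normal_tuple_def)
  obtain C where C: "C \<ge> 0" "\<And>x. (norm x)\<^sup>2 \<le> C * (\<Sum>k=1..d. (norm (N k x))\<^sup>2)"
    using range closed_tuple_range_iff_bounded_below[OF closed_csubspace_UNIV N ker] by auto
  have below: "norm x \<le> C * norm (gram x)" for x
  proof (cases "x = 0")
    case False
    have "(norm x)\<^sup>2 \<le> C * (\<Sum>k=1..d. (norm (N k x))\<^sup>2)" by (rule C)
    also have "\<dots> \<le> C * (norm (gram x) * norm x)"
      unfolding Re_cinner_gram[symmetric] Re_cinner by (intro mult_left_mono norm_cauchy_schwarz C)
    finally show ?thesis using False by (simp add: power2_eq_square)
  qed (simp add: C(1))
  then have gram_eq_0: "x = 0" if "gram x = 0" for x using below[of x] that by simp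
  note lin = bounded_op_bounded_linear[OF bounded_op_gram, THEN bounded_linear.linear]
  have "inj gram"
    using gram_eq_0 by (subst linear_injective_0[OF lin]) blast
  moreover have "surj gram"
  proof -
    \<comment> \<open>The criterion for tuples, applied to the single operator \<open>gram\<close>
      as a tuple of length one.\<close>
    have "closed_tuple_range 1 UNIV (\<lambda>_. gram)"
      using below bounded_op_gram
      by (intro bounded_below_imp_closed_tuple_range[where C = "C"] closed_csubspace_UNIV)
        (auto simp: bounded_tuple_def)
    then have seq: "\<forall>X y. (\<forall>k\<in>{1..1::nat}. (\<lambda>n. gram (X n)) \<longlonglongrightarrow> y k) \<longrightarrow>
        (\<exists>x. \<forall>k\<in>{1..1::nat}. gram x = y k)"
      by (subst (asm) closed_tuple_range_iff) auto
    have "closed (range gram)"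
      unfolding closed_sequential_limits
    proof (intro allI impI, elim conjE)
      fix Y y assume "\<forall>n. Y n \<in> range gram" "Y \<longlonglongrightarrow> y"
      then obtain X where "Y = (\<lambda>n. gram (X n))" unfolding image_iff by metis
      then show "y \<in> range gram"
        using seq[rule_format, of X "\<lambda>_. y"] \<open>Y \<longlonglongrightarrow> y\<close> by auto
    qed
    moreover have "csubspace (range gram)"
      unfolding complex_vector.subspace_def
      using bounded_op_gram linear_0[OF lin] unfolding bounded_op_def
      by (auto simp: image_iff) metis+
    ultimately have cl: "closed_csubspace (range gram)" by (simp add: closed_csubspace_def)
    have "y \<in> range gram" for y
    proof -
      obtain u v where uv: "u \<in> range gram" "v \<in> UNIV \<ominus> range gram" "y = u + v"
        using orthogonal_decomposition[OF cl] by blast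
      \<comment> \<open>Testing \<open>v\<close> against the element \<open>gram (gram v)\<close> of
        the range and moving one \<open>gram\<close> across.\<close>
      have "cinner (gram v) (gram v) = 0"
        using cinner_ortho_diff(1)[OF uv(2), of "gram (gram v)"] by (simp add: cinner_gram_right)
      then have "v = 0" by (simp add: cinner_self gram_eq_0)
      then show ?thesis using uv by simp
    qed
    then show ?thesis by blast
  qed
  ultimately show ?thesis by (simp add: bij_def)
qed

lemma normal_tuple_taylor_invertible_iff:
  assumes ker: "tuple_kernel d UNIV N = {0}"
  shows "taylor_invertible d UNIV N \<longleftrightarrow> closed_tuple_range d UNIV N"
proof
  assume "taylor_invertible d UNIV N"
  then show "closed_tuple_range d UNIV N"
    using koszul_exact_imp_closed_tuple_range[of d N] normal_tuple_bounded_linear normal_tuple_commute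
    by (auto simp: taylor_invertible_def)
next
  assume range: "closed_tuple_range d UNIV N"
  have "koszul_exact d UNIV N"
    by (rule koszul_exactI[of d N "\<lambda>k. adj UNIV (N k)"])
      (simp_all only: normal_tuple_bounded_linear normal_tuple_commute normal_tuple_adj_commute
        bij_gram[OF ker range, unfolded gram_def[abs_def]])
  then show "taylor_invertible d UNIV N"
    using normal by (simp add: taylor_invertible_def normal_tuple_def)
qed

end

section \<open>Pure spherically quasinormal tuples and their minimal normal extensions\<close>

locale normal_extension =
  fixes d :: nat and H :: "'a::chilbert_space set" and T N :: "nat \<Rightarrow> 'a \<Rightarrow> 'a"
  assumes H: "closed_csubspace H"
    and quasinormal: "spherically_quasinormal d H T"
    and pure: "pure_tuple d H T"
    and extension: "minimal_normal_extension d H T N"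
begin

lemma normal: "normal_tuple d UNIV N"
  using extension by (simp add: minimal_normal_extension_def)

lemma T_op: "k \<in> {1..d} \<Longrightarrow> bounded_op H H (T k)"
  using quasinormal by (simp add: spherically_quasinormal_def bounded_tuple_def)

lemma N_eq_T: "k \<in> {1..d} \<Longrightarrow> x \<in> H \<Longrightarrow> N k x = T k x"
  using extension by (simp add: minimal_normal_extension_def)

lemma T_mem: "k \<in> {1..d} \<Longrightarrow> x \<in> H \<Longrightarrow> T k x \<in> H"
  using T_op by (auto simp: bounded_op_def)

abbreviation (input) P :: "'a \<Rightarrow> 'a" where "P \<equiv> gram d N"

text \<open>
  With \<open>Q = \<Sum>\<^sub>j T\<^sub>j\<^sup>*T\<^sub>j\<close>, the compression of \<open>P = \<Sum>\<^sub>j N\<^sub>j\<^sup>*N\<^sub>j\<close> to \<open>H\<close>, quasinormality gives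
  \<open>\<langle>Px, Px\<rangle> = \<Sum>\<^sub>j \<langle>P T\<^sub>j x, T\<^sub>j x\<rangle> = \<Sum>\<^sub>j \<langle>T\<^sub>j Q x, T\<^sub>j x\<rangle> = \<langle>Qx, Qx\<rangle>\<close>, so that \<open>Px\<close> does not leave \<open>H\<close>.
\<close>

lemma gram_mem:
  assumes x: "x \<in> H"
  shows "P x \<in> H"
proof -
  define Q where "Q x = (\<Sum>j=1..d. adj H (T j) (T j x))" for x
  have Q_mem: "Q x \<in> H" for x
    unfolding Q_def by (intro closed_csubspace_sum[OF H] adj_mem[OF H T_op])
  have Q_T: "Q (T j x) = T j (Q x)" if "j \<in> {1..d}" for j
    using quasinormal that x by (simp add: spherically_quasinormal_def Q_def)
  have PQ: "cinner (P x) y = cinner (Q x) y" if "x \<in> H" "y \<in> H" for x y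
  proof -
    have "cinner y (Q x) = (\<Sum>j=1..d. cinner (T j y) (T j x))"
      unfolding Q_def cinner.sum_right
      by (intro sum.cong refl cinner_adj[OF H T_op, symmetric] that)
    also have "\<dots> = cinner (P y) x"
      using that by (simp add: cinner_gram[OF normal] N_eq_T)
    finally have "cinner y (Q x) = cinner y (P x)" by (simp add: cinner_gram_right[OF normal])
    then show ?thesis by (metis cinner_commute)
  qed
  have "cinner (P x) (P x) = cinner (P (P x)) x"
    by (rule cinner_gram_right[OF normal])
  also have "\<dots> = (\<Sum>j=1..d. cinner (P (N j x)) (N j x))"
    by (simp add: cinner_gram[OF normal, of "P x"] gram_commute[OF normal])
  also have "\<dots> = (\<Sum>j=1..d. cinner (N j (Q x)) (N j x))"
    using x by (intro sum.cong refl) (simp add: N_eq_T T_mem PQ Q_T Q_mem)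
  also have "\<dots> = cinner (P (Q x)) x" by (simp add: cinner_gram[OF normal])
  also have "\<dots> = cinner (Q x) (P x)" by (simp add: cinner_gram_right[OF normal])
  finally have "cinner (P x) (P x) = cinner (Q x) (P x)" .
  moreover have "cinner (P x) (Q x) = cinner (Q x) (Q x)"
    using x by (simp add: PQ Q_mem)
  \<comment> \<open>\<open>Q x\<close> is the orthogonal projection of \<open>P x\<close> to
    \<open>H\<close>; equality of their norms leaves no component outside \<open>H\<close>.\<close>
  ultimately have "cinner (P x - Q x) (P x - Q x) = 0"
    by (simp add: cinner.diff_left cinner.diff_right)
  then have "P x = Q x" by (simp add: cinner_self)
  then show ?thesis using Q_mem by simp
qed

lemma gram_mem_ortho:
  assumes "y \<in> UNIV \<ominus> H"
  shows "P y \<in> UNIV \<ominus> H"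
  using assms gram_mem cinner_gram_right[OF normal, of y, symmetric] by (auto simp: ortho_diff_def)

lemma norm_N_orthogonal_sum:
  assumes "u \<in> H" "v \<in> UNIV \<ominus> H"
  shows "(\<Sum>k=1..d. (norm (N k (u + v)))\<^sup>2) =
    (\<Sum>k=1..d. (norm (N k u))\<^sup>2) + (\<Sum>k=1..d. (norm (N k v))\<^sup>2)"
proof -
  have "P (u + v) = P u + P v"
    using bounded_op_gram[OF normal] by (simp add: bounded_op_def)
  moreover have "cinner (P u) v = 0" "cinner (P v) u = 0"
    using assms gram_mem gram_mem_ortho cinner_ortho_diff by metis+
  ultimately show ?thesis
    unfolding Re_cinner_gram[OF normal, symmetric] by (simp add: cinner_add_left cinner_add_right)
qed

text \<open>The common kernel \<open>M\<close> carries the zero tuple, which is normal, so purity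
  excludes \<open>M \<noteq> {0}\<close> once \<open>M\<close> reduces \<open>T\<close>. It does:
  normality of \<open>N k\<close> turns \<open>N k y = 0\<close> into the same for the adjoint, so
  the range of \<open>T k\<close> is orthogonal to \<open>M\<close>.\<close>

lemma kernel_T: "tuple_kernel d H T = {0}"
proof (rule ccontr)
  define M where "M = tuple_kernel d H T"
  assume "tuple_kernel d H T \<noteq> {0}"
  then have "M \<noteq> {0}" by (simp add: M_def)
  have M_eq: "M = H \<inter> (\<Inter>k\<in>{1..d}. {x. N k x = 0})"
    using N_eq_T by (auto simp: M_def tuple_kernel_def)
  have M_H: "M \<subseteq> H" by (simp add: M_eq)
  have TM: "T k x = 0" if "k \<in> {1..d}" "x \<in> M" for k x
    using that by (auto simp: M_def tuple_kernel_def)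
  have "closed {x. N k x = 0}" if "k \<in> {1..d}" for k
    using normal_tuple_bounded_linear(1)[OF normal that]
    by (intro closed_Collect_eq continuous_on_const linear_continuous_on)
  then have "closed M"
    using H unfolding M_eq by (intro closed_Int closed_INT) (auto simp: closed_csubspace_def)
  moreover have "csubspace M"
    unfolding complex_vector.subspace_def M_def tuple_kernel_def
    by (auto simp: closed_csubspace_0[OF H] closed_csubspace_add[OF H] closed_csubspace_scaleC[OF H]
        bounded_op_0[OF T_op H] bounded_op_add[OF T_op H] bounded_op_scaleC[OF T_op H]
        complex_vector.scale_zero_right)
  ultimately have M: "closed_csubspace M" by (simp add: closed_csubspace_def)
  have "reduces H M (T k)" if k: "k \<in> {1..d}" for k
  proof -
    have "cinner (T k w) y = 0" if w: "w \<in> H" and y: "y \<in> M" for w y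
    proof -
      have "adj UNIV (N k) y = 0"
        using norm_adj_normal_tuple[OF normal k, of y] TM[OF k y] N_eq_T[OF k, of y] M_H y by auto
      then show ?thesis
        using normal_tuple_cinner_adj(1)[OF normal k, of w y] N_eq_T[OF k w]
        by (simp add: cinner.zero_right)
    qed
    then show ?thesis
      using T_mem[OF k] TM[OF k] closed_csubspace_0[OF M] by (auto simp: reduces_def ortho_diff_def)
  qed
  moreover have "normal_tuple d M T"
  proof -
    have "bounded_op M M (T k)" if "k \<in> {1..d}" for k
      using TM[OF that] closed_csubspace_0[OF M] closed_csubspace_add[OF M] closed_csubspace_scaleC[OF M]
      by (auto simp: bounded_op_def complex_vector.scale_zero_right intro!: exI[of _ 0])
    moreover have "adj M (T k) x = 0" if "k \<in> {1..d}" for k x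
      using TM[OF that] closed_csubspace_0[OF M]
      by (intro adj_eqI[OF M]) (auto simp: cinner.zero_left cinner.zero_right)
    moreover have "T k 0 = 0" if "k \<in> {1..d}" for k
      using TM[OF that] closed_csubspace_0[OF M] by blast
    ultimately show ?thesis
      using TM by (auto simp: normal_tuple_def bounded_tuple_def commuting_tuple_def)
  qed
  ultimately show False
    using pure M M_H \<open>M \<noteq> {0}\<close> unfolding pure_tuple_def by blast
qed

text \<open>The complement \<open>M\<close> of the kernel reduces \<open>N\<close>, so by minimality
  it suffices that \<open>M\<close> contains \<open>H\<close>. For \<open>y\<close> in the kernel
  the form splits into two nonnegative parts that must both vanish, so the component of
  \<open>y\<close> in \<open>H\<close> lies in the kernel of \<open>T\<close> and is 0.\<close>

lemma kernel_N: "tuple_kernel d UNIV N = {0}"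
proof -
  define K where "K = tuple_kernel d UNIV N"
  define M where "M = UNIV \<ominus> K"
  have M: "closed_csubspace M"
    unfolding M_def by (intro closed_csubspace_ortho_diff closed_csubspace_UNIV)
  have NK: "N k y = 0" "adj UNIV (N k) y = 0" if "k \<in> {1..d}" "y \<in> K" for k y
    using that norm_adj_normal_tuple[OF normal, of k y] by (auto simp: K_def tuple_kernel_def)
  have "h \<in> M" if h: "h \<in> H" for h
  proof -
    have "cinner h y = 0" if y: "y \<in> K" for y
    proof -
      obtain u v where uv: "u \<in> H" "v \<in> UNIV \<ominus> H" "y = u + v"
        using orthogonal_decomposition[OF H] by blast
      have "(\<Sum>k=1..d. (norm (N k u))\<^sup>2) + (\<Sum>k=1..d. (norm (N k v))\<^sup>2) = 0"
        using norm_N_orthogonal_sum[OF uv(1,2)] NK(1)[OF _ y] uv(3) by simp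
      then have "(\<Sum>k=1..d. (norm (N k u))\<^sup>2) = 0"
        by (simp add: add_nonneg_eq_0_iff sum_nonneg)
      then have "u \<in> tuple_kernel d H T"
        using uv(1) N_eq_T by (auto simp: sum_nonneg_eq_0_iff tuple_kernel_def)
      then have "y = v" using kernel_T uv by simp
      then show ?thesis using cinner_ortho_diff(2)[OF uv(2) h] by simp
    qed
    then show ?thesis by (auto simp: M_def ortho_diff_def)
  qed
  moreover have "reduces UNIV M (N k)" if k: "k \<in> {1..d}" for k
  proof -
    note adj = normal_tuple_cinner_adj[OF normal k]
    have "N k m \<in> M" if "m \<in> M" for m
      using that NK(2)[OF k] by (auto simp: M_def ortho_diff_def adj cinner.zero_right)
    moreover have "adj UNIV (N k) m \<in> M" if "m \<in> M" for m
      using that NK(1)[OF k] by (auto simp: M_def ortho_diff_def adj cinner.zero_right)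
    then have "N k w \<in> UNIV \<ominus> M" if "w \<in> UNIV \<ominus> M" for w
      using that by (auto simp: ortho_diff_def adj)
    ultimately show ?thesis by (auto simp: reduces_def)
  qed
  ultimately have "M = UNIV"
    using extension M unfolding minimal_normal_extension_def by blast
  then have "cinner x x = 0" if "x \<in> K" for x
    using that by (auto simp: M_def ortho_diff_def set_eq_iff)
  then have "K \<subseteq> {0}" by (auto simp: cinner_self)
  moreover have "0 \<in> K"
    using bounded_op_0[OF normal_tuple_op[OF normal] closed_csubspace_UNIV]
    by (auto simp: K_def tuple_kernel_def)
  ultimately show ?thesis by (auto simp: K_def)
qed

text \<open>The adjoint of the block matrix has the adjoint of the lower left zero in its upper
  right corner, and \<open>S k\<close> below it.\<close>

lemma dual_eq_adj:
  assumes dual: "is_dual d H T N S" and k: "k \<in> {1..d}" and y: "y \<in> UNIV \<ominus> H"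
  shows "adj UNIV (N k) y = S k y"
proof (rule adj_UNIV_unique)
  fix x
  let ?H' = "UNIV \<ominus> H"
  have H': "closed_csubspace ?H'" by (intro closed_csubspace_ortho_diff closed_csubspace_UNIV)
  have S: "bounded_op ?H' ?H' (S k)" using dual k by (simp add: is_dual_def bounded_tuple_def)
  obtain A where A: "bounded_op ?H' H A" "\<And>u v. u \<in> H \<Longrightarrow> v \<in> ?H' \<Longrightarrow>
      N k (u + v) = (T k u + A v) + adj ?H' (S k) v"
    using dual k unfolding is_dual_def by blast
  obtain u v where uv: "u \<in> H" "v \<in> ?H'" "x = u + v"
    using orthogonal_decomposition[OF H] by blast
  have "T k u \<in> H" "A v \<in> H"
    using A(1) uv T_mem[OF k] by (auto simp: bounded_op_def)
  then have "cinner (N k x) y = cinner (adj ?H' (S k) v) y"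
    using A(2)[OF uv(1,2)] uv(3) cinner_ortho_diff(2)[OF y] by (simp add: cinner_add_left)
  also have "\<dots> = cinner v (S k y)"
    using cinner_adj[OF H' S y] by (metis cinner_commute)
  also have "\<dots> = cinner x (S k y)"
    using S y uv cinner_ortho_diff(2)[of "S k y" UNIV H u] by (auto simp: bounded_op_def cinner_add_left)
  finally show "cinner (N k x) y = cinner x (S k y)" .
qed

text \<open>One form \<open>?q\<close> governs all three ranges: on the complement
  \<open>S k\<close> is the restriction of the adjoint of \<open>N k\<close>, and a normal operator
  and its adjoint have equal norms at each vector. A bound on the whole space restricts to both
  summands; conversely the constants of the summands are added.\<close>

lemma closed_range_iff_dual:
  assumes dual: "is_dual d H T N S"
  shows "tuple_kernel d (UNIV \<ominus> H) S = {0}"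
    and "closed_tuple_range d UNIV N \<longleftrightarrow>
      closed_tuple_range d H T \<and> closed_tuple_range d (UNIV \<ominus> H) S"
proof -
  let ?H' = "UNIV \<ominus> H"
  let ?q = "\<lambda>x. \<Sum>k=1..d. (norm (N k x))\<^sup>2"
  have H': "closed_csubspace ?H'" by (intro closed_csubspace_ortho_diff closed_csubspace_UNIV)
  have S: "bounded_tuple d ?H' S" using dual by (simp add: is_dual_def)
  have norm_S: "norm (S k y) = norm (N k y)" if "k \<in> {1..d}" "y \<in> ?H'" for k y
    using dual_eq_adj[OF dual that] norm_adj_normal_tuple[OF normal that(1), of y] by simp
  have "S k y = 0 \<longleftrightarrow> N k y = 0" if "k \<in> {1..d}" "y \<in> ?H'" for k y
    using norm_S[OF that] by (metis norm_eq_zero)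
  then have "tuple_kernel d ?H' S = ?H' \<inter> tuple_kernel d UNIV N"
    by (auto simp: tuple_kernel_def)
  then show kernel_S: "tuple_kernel d ?H' S = {0}"
    using kernel_N closed_csubspace_0[OF H'] by auto
  have T: "bounded_tuple d H T" and N: "bounded_tuple d UNIV N"
    using T_op normal by (auto simp: bounded_tuple_def normal_tuple_def)
  have N_iff: "closed_tuple_range d UNIV N \<longleftrightarrow> (\<exists>C\<ge>0. \<forall>x. (norm x)\<^sup>2 \<le> C * ?q x)"
    using closed_tuple_range_iff_bounded_below[OF closed_csubspace_UNIV N kernel_N] by simp
  have T_iff: "closed_tuple_range d H T \<longleftrightarrow> (\<exists>C\<ge>0. \<forall>x\<in>H. (norm x)\<^sup>2 \<le> C * ?q x)"
    using closed_tuple_range_iff_bounded_below[OF H T kernel_T] by (simp add: N_eq_T)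
  have S_iff: "closed_tuple_range d ?H' S \<longleftrightarrow> (\<exists>C\<ge>0. \<forall>x\<in>?H'. (norm x)\<^sup>2 \<le> C * ?q x)"
    using closed_tuple_range_iff_bounded_below[OF H' S kernel_S] by (simp add: norm_S)
  show "closed_tuple_range d UNIV N \<longleftrightarrow> closed_tuple_range d H T \<and> closed_tuple_range d ?H' S"
  proof
    assume "closed_tuple_range d H T \<and> closed_tuple_range d ?H' S"
    then obtain C D where C: "C \<ge> 0" "\<And>x. x \<in> H \<Longrightarrow> (norm x)\<^sup>2 \<le> C * ?q x"
      and D: "D \<ge> 0" "\<And>x. x \<in> ?H' \<Longrightarrow> (norm x)\<^sup>2 \<le> D * ?q x"
      unfolding T_iff S_iff by blast
    have "(norm x)\<^sup>2 \<le> (C + D) * ?q x" for x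
    proof -
      obtain u v where uv: "u \<in> H" "v \<in> ?H'" "x = u + v"
        using orthogonal_decomposition[OF H] by blast
      have "inner u v = 0" using cinner_ortho_diff(2)[OF uv(2,1)] Re_cinner[of u v] by simp
      then have "(norm x)\<^sup>2 = (norm u)\<^sup>2 + (norm v)\<^sup>2"
        unfolding uv(3) power2_norm_eq_inner by (simp add: inner_add inner_commute)
      also have "\<dots> \<le> C * ?q u + D * ?q v" using C D uv by (intro add_mono) auto
      also have "\<dots> \<le> (C + D) * (?q u + ?q v)"
        using C D by (simp add: algebra_simps sum_nonneg)
      finally show ?thesis unfolding uv(3) norm_N_orthogonal_sum[OF uv(1,2)] .
    qed
    then show "closed_tuple_range d UNIV N" unfolding N_iff using C D by (intro exI[of _ "C + D"]) simp
  qed (auto simp: N_iff T_iff S_iff)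
qed

end

theorem theorem3p6:
  fixes d :: nat
    and H :: "'k::chilbert_space set"
    and T N S :: "nat \<Rightarrow> 'k \<Rightarrow> 'k"
  assumes "closed_csubspace H"
    and "spherically_quasinormal d H T"
    and "pure_tuple d H T"
    and "minimal_normal_extension d H T N"
    and "is_dual d H T N S"
  shows "(taylor_invertible d UNIV N \<longleftrightarrow> closed_tuple_range d UNIV N) \<and>
         (closed_tuple_range d UNIV N \<longleftrightarrow>
            closed_tuple_range d H T \<and> closed_tuple_range d (UNIV \<ominus> H) S) \<and>
         (closed_tuple_range d H T \<and> closed_tuple_range d (UNIV \<ominus> H) S \<longleftrightarrow>
            left_taylor_invertible d H T \<and> left_taylor_invertible d (UNIV \<ominus> H) S)"
proof -
  interpret normal_extension d H T N by standard (use assms in auto)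
  show ?thesis
    using normal_tuple_taylor_invertible_iff[OF normal kernel_N] closed_range_iff_dual[OF assms(5)] kernel_T
    by (auto simp: left_taylor_invertible_def)
qed

end
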